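(* Let $v$ be an object of an indecomposable admissible component of the root groupoid. For every $v'\in\mathrm{Sk}(v)$ there exist a unique $v''\in\mathrm{Sp}(v)$ and a unique $w\in W=W(v)$ such that $v'=w(v'')$. The cardinality of the set $\Delta^+_{an}(v)\setminus\Delta^+_{an}(v')$ is equal to $\ell(w)$.
   Context: Root groupoid. Fix a finite set $X$. A root datum is a quadruple $v=(\mathfrak h,a,b,p)$ with $\mathfrak h$ a finite-dimensional complex vector space, $a:X\to\mathfrak h$, $b:X\to\mathfrak h^*$ such that the families $(a(x))_{x\in X}$ and $(b(x))_{x\in X}$ are linearly independent, and $p:X\to\mathbb Z_2$; we write $\mathfrak h(v),a_v,b_v,p_v$. Its Cartan matrix is $a_{xy}=\langle a(x),b(y)\rangle$. An element $x\in X$ is reflectable at $v$ if: $a_{xx}=0$ implies $p(x)=1$; if $a_{xx}\ne 0$ and $p(x)=0$ then $2a_{xy}/a_{xx}\in\mathbb Z_{\le 0}$ for all $y\ne x$; if $a_{xx}\neq 0$ and $p(x)=1$ then $a_{xy}/a_{xx}\in\mathbb Z_{\le 0}$ for all $y\ne x$. For $x$ reflectable at $v$ the reflexion $r_x:v\to v'=(\mathfrak h,a',b',p')$ is defined as follows. Anisotropic case $a_{xx}\ne0$: $p'=p$, $a'(y)=a(y)-2\frac{a_{yx}}{a_{xx}}a(x)$, $b'(y)=b(y)-2\frac{a_{xy}}{a_{xx}}b(x)$. Isotropic case $a_{xx}=0$: $(a'(x),b'(x),p'(x))=(-a(x),-b(x),p(x))$; for $y\neq x$ with $a_{xy}=0$,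 $(a'(y),b'(y),p'(y))=(a(y),b(y),p(y))$; for $y$ with $a_{xy}\ne0$, $(a'(y),b'(y),p'(y))=(a(y)+\frac{a_{yx}}{a_{xy}}a(x),\,b(y)+b(x),\,1+p(y))$. The root groupoid $\mathcal R$ has the root data as objects; its arrows are generated by reflexions, tautological arrows $t_\theta:(\mathfrak h,a,b,p)\to(\mathfrak h',\theta\circ a,(\theta^* )^{-1}\circ b,p)$ for linear isomorphisms $\theta:\mathfrak h\to\mathfrak h'$, and homotheties $h_\lambda:(\mathfrak h,a,b,p)\to(\mathfrak h,\lambda a,b,p)$ for $\lambda:X\to\mathbb C^*$. Each generator induces a linear isomorphism of the spaces $\mathfrak h$ (the identity for reflexions and homotheties, $\theta$ for $t_\theta$), and two compositions of generators $v\to v'$ are identified iff they induce the same isomorphism $\mathfrak h(v)\to\mathfrak h(v')$. A component is a connected component of $\mathcal R$; it is indecomposable if for $v$ in it there is no partition $X=X_1\sqcup X_2$ into nonempty subsets with $a_{xy}=a_{yx}=0$ for $x\in X_1,y\in X_2$. Admissibility. The half-baked Lie superalgebra $\tilde{\mathfrak g}(v)$ is generated by $\mathfrak h(v)$ (even) and $\tilde e_x,\tilde f_x$ ($x\in X$, of parity $p(x)$) with relations $[\mathfrak h,\mathfrak h]=0$, $[h,\tilde e_x]=\langle b(x),h\rangle\tilde e_x$, $[h,\tilde f_x]=-\langle b(x),h\rangle\tilde f_x$, $[\tilde e_x,\tilde f_y]=0$ for $x\ne y$, $[\tilde e_x,\tilde f_x]=a(x)$. A component $\mathcal R_0$ is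 admissible if there is a collection of quotients $\mathfrak g(v)=\tilde{\mathfrak g}(v)/I(v)$, $v\in\mathcal R_0$, with $I(v)\cap\mathfrak h(v)=0$, such that for each arrow $v\to v'$ in $\mathcal R_0$ the induced isomorphism $\mathfrak h(v)\to\mathfrak h(v')$ extends to an isomorphism $\mathfrak g(v)\to\mathfrak g(v')$. Equivalently: at every $v\in\mathcal R_0$, if $x$ is reflectable at $v$ and $a_{xy}=0$ then $a_{yx}=0$. Skeleton and Weyl group. $\mathrm{Sk}(v)$ is the set of objects obtained from $v$ by chains of reflexions, $\mathrm{Sp}(v)\subset\mathrm{Sk}(v)$ those obtained by chains of isotropic reflexions; all have the same $\mathfrak h=\mathfrak h(v)$. Real roots: $\Delta^{re}=\{b_u(x):u\in\mathrm{Sk}(v),x\in X\}$. A real root $\alpha=b_u(x)$ with $x$ reflectable at $u$ and $a_{xx}\ne0$ at $u$ is called anisotropic; $\Delta_{an}$ is the set of these; $\alpha^\vee=2a_u(x)/a_{xx}$ (independent of choices), $s_\alpha(h)=h-\langle\alpha,h\rangle\alpha^\vee$. $W(v)\subset GL(\mathfrak h)$ is generated by all $s_\alpha$, $\alpha\in\Delta_{an}$. $W(v)$ acts on $\mathrm{Sk}(v)$: $w(u)$ is the unique vertex of $\mathrm{Sk}(v)$ with $a_{w(u)}(y)=w(a_u(y))$, $b_{w(u)}(y)=w(b_u(y))$, $p_{w(u)}=p_u$. An anisotropic real root is $v$-principal if it equals $b_{v'}(x)$ for some $v'\in\mathrm{Sp}(v)$, $x\in X$. $W(v)$ is generated by the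 reflections in $v$-principal roots, and $\ell(w)$ is the minimal number of such reflections in an expression of $w$. For $u\in\mathrm{Sk}(v)$, $\Delta^+_{an}(u)=\Delta_{an}\cap\sum_{x}\mathbb Z_{\ge0}b_u(x)$. *)

theory Defs
  imports Complex_Main "HOL-Library.Z2" "HOL-Library.Nonpos_Ints"
begin

section \<open>Root data\<close>

text \<open>
  The finite index set \<open>X\<close> is the finite type \<open>'x\<close>.  The space \<open>\<hh>\<close> of a root datum is the type
  \<open>'h\<close> with the scalar multiplication \<open>smult\<close> stored in the datum.  All spaces occurring in a
  component of the root groupoid are isomorphic, so that, up to tautological arrows, no object of
  a component is lost by keeping the underlying additive group fixed.
\<close>

record ('h, 'x) root_data =
  smult :: "complex \<Rightarrow> 'h \<Rightarrow> 'h"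
  cor :: "'x \<Rightarrow> 'h"
  rt :: "'x \<Rightarrow> 'h \<Rightarrow> complex"
  par :: "'x \<Rightarrow> bit"

definition is_root_datum :: "('h::ab_group_add, 'x::finite) root_data \<Rightarrow> bool" where
  "is_root_datum v \<longleftrightarrow>
     vector_space (smult v) \<and>
     (\<exists>B. finite B \<and> module.span (smult v) B = UNIV) \<and>
     (\<forall>x. Vector_Spaces.linear (smult v) (*) (rt v x)) \<and>
     (\<forall>c. (\<Sum>x\<in>UNIV. smult v (c x) (cor v x)) = 0 \<longrightarrow> (\<forall>x. c x = 0)) \<and>
     (\<forall>c. (\<forall>h. (\<Sum>x\<in>UNIV. c x * rt v x h) = 0) \<longrightarrow> (\<forall>x. c x = 0))"

definition cartan :: "('h, 'x) root_data \<Rightarrow> 'x \<Rightarrow> 'x \<Rightarrow> complex" where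
  "cartan v x y = rt v y (cor v x)"

definition reflectable :: "('h, 'x) root_data \<Rightarrow> 'x \<Rightarrow> bool" where
  "reflectable v x \<longleftrightarrow>
     (cartan v x x = 0 \<longrightarrow> par v x = 1) \<and>
     (cartan v x x \<noteq> 0 \<and> par v x = 0 \<longrightarrow>
        (\<forall>y. y \<noteq> x \<longrightarrow> 2 * cartan v x y / cartan v x x \<in> \<int>\<^sub>\<le>\<^sub>0)) \<and>
     (cartan v x x \<noteq> 0 \<and> par v x = 1 \<longrightarrow>
        (\<forall>y. y \<noteq> x \<longrightarrow> cartan v x y / cartan v x x \<in> \<int>\<^sub>\<le>\<^sub>0))"

definition anisotropic_reflexion ::
    "('h::ab_group_add, 'x) root_data \<Rightarrow> 'x \<Rightarrow> ('h, 'x) root_data" where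
  "anisotropic_reflexion v x = v
     \<lparr>cor := \<lambda>y. cor v y - smult v (2 * cartan v y x / cartan v x x) (cor v x),
      rt := \<lambda>y h. rt v y h - 2 * cartan v x y / cartan v x x * rt v x h\<rparr>"

definition isotropic_reflexion ::
    "('h::ab_group_add, 'x) root_data \<Rightarrow> 'x \<Rightarrow> ('h, 'x) root_data" where
  "isotropic_reflexion v x = v
     \<lparr>cor := \<lambda>y. if y = x then - cor v x
                 else if cartan v x y = 0 then cor v y
                 else cor v y + smult v (cartan v y x / cartan v x y) (cor v x),
      rt := \<lambda>y. if y = x then (\<lambda>h. - rt v x h)
                else if cartan v x y = 0 then rt v y
                else (\<lambda>h. rt v y h + rt v x h),
      par := \<lambda>y. if y = x then par v x
                 else if cartan v x y = 0 then par v y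
                 else 1 + par v y\<rparr>"

definition reflexion :: "('h::ab_group_add, 'x) root_data \<Rightarrow> 'x \<Rightarrow> ('h, 'x) root_data" where
  "reflexion v x =
     (if cartan v x x \<noteq> 0 then anisotropic_reflexion v x else isotropic_reflexion v x)"


section \<open>The root groupoid\<close>

text \<open>
  Compositions of generators are identified iff they induce the same linear isomorphism, so an
  arrow \<open>v \<rightarrow> v'\<close> is the same thing as the isomorphism \<open>\<phi>\<close> it induces.
\<close>

inductive arrow ::
    "('h::ab_group_add, 'x::finite) root_data \<Rightarrow> ('h, 'x) root_data \<Rightarrow> ('h \<Rightarrow> 'h) \<Rightarrow> bool" where
  arrow_refl: "is_root_datum v \<Longrightarrow> arrow v v id"
| arrow_reflexion: "is_root_datum v \<Longrightarrow> reflectable v x \<Longrightarrow> arrow v (reflexion v x) id"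
| arrow_taut: "is_root_datum v \<Longrightarrow> is_root_datum v' \<Longrightarrow>
    Vector_Spaces.linear (smult v) (smult v') \<theta> \<Longrightarrow> bij \<theta> \<Longrightarrow>
    cor v' = \<theta> \<circ> cor v \<Longrightarrow> rt v' = (\<lambda>x. rt v x \<circ> inv \<theta>) \<Longrightarrow> par v' = par v \<Longrightarrow>
    arrow v v' \<theta>"
| arrow_homothety: "is_root_datum v \<Longrightarrow> (\<And>x. c x \<noteq> 0) \<Longrightarrow>
    arrow v (v\<lparr>cor := \<lambda>x. smult v (c x) (cor v x)\<rparr>) id"
| arrow_comp: "arrow v v' \<phi> \<Longrightarrow> arrow v' v'' \<psi> \<Longrightarrow> arrow v v'' (\<psi> \<circ> \<phi>)"
| arrow_inv: "arrow v v' \<phi> \<Longrightarrow> arrow v' v (inv \<phi>)"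

definition component ::
    "('h::ab_group_add, 'x::finite) root_data \<Rightarrow> ('h, 'x) root_data set" where
  "component v = {v'. \<exists>\<phi>. arrow v v' \<phi>}"

definition indecomposable :: "('h, 'x) root_data set \<Rightarrow> bool" where
  "indecomposable R \<longleftrightarrow>
     (\<forall>v\<in>R. \<not> (\<exists>X1 X2. X1 \<noteq> {} \<and> X2 \<noteq> {} \<and> X1 \<union> X2 = UNIV \<and> X1 \<inter> X2 = {} \<and>
        (\<forall>x\<in>X1. \<forall>y\<in>X2. cartan v x y = 0 \<and> cartan v y x = 0)))"


section \<open>Lie superalgebras, graded ideals and quotients\<close>

record 'g lsa =
  carr :: "'g set"
  zer :: 'g
  add :: "'g \<Rightarrow> 'g \<Rightarrow> 'g"
  scl :: "complex \<Rightarrow> 'g \<Rightarrow> 'g"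
  brk :: "'g \<Rightarrow> 'g \<Rightarrow> 'g"
  homog :: "bit \<Rightarrow> 'g set"

definition graded_ideal :: "'g lsa \<Rightarrow> 'g set \<Rightarrow> bool" where
  "graded_ideal L I \<longleftrightarrow>
     I \<subseteq> carr L \<and> zer L \<in> I \<and>
     (\<forall>a\<in>I. \<forall>b\<in>I. add L a b \<in> I) \<and>
     (\<forall>c. \<forall>a\<in>I. scl L c a \<in> I) \<and>
     (\<forall>a\<in>I. \<forall>g\<in>carr L. brk L g a \<in> I \<and> brk L a g \<in> I) \<and>
     (\<forall>a\<in>I. \<exists>a0\<in>I \<inter> homog L 0. \<exists>a1\<in>I \<inter> homog L 1. a = add L a0 a1)"

definition coset :: "'g lsa \<Rightarrow> 'g set \<Rightarrow> 'g \<Rightarrow> 'g set" where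
  "coset L I g = {add L g a | a. a \<in> I}"

definition quotient_lsa :: "'g lsa \<Rightarrow> 'g set \<Rightarrow> 'g set lsa" where
  "quotient_lsa L I =
     \<lparr>carr = coset L I ` carr L,
      zer = coset L I (zer L),
      add = (\<lambda>A B. \<Union>g\<in>A. \<Union>k\<in>B. coset L I (add L g k)),
      scl = (\<lambda>c A. \<Union>g\<in>A. coset L I (scl L c g)),
      brk = (\<lambda>A B. \<Union>g\<in>A. \<Union>k\<in>B. coset L I (brk L g k)),
      homog = (\<lambda>i. coset L I ` homog L i)\<rparr>"

definition lsa_iso :: "'g lsa \<Rightarrow> 'k lsa \<Rightarrow> ('g \<Rightarrow> 'k) \<Rightarrow> bool" where
  "lsa_iso L M \<Psi> \<longleftrightarrow>
     bij_betw \<Psi> (carr L) (carr M) \<and>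
     (\<forall>g\<in>carr L. \<forall>k\<in>carr L. \<Psi> (add L g k) = add M (\<Psi> g) (\<Psi> k)) \<and>
     (\<forall>c. \<forall>g\<in>carr L. \<Psi> (scl L c g) = scl M c (\<Psi> g)) \<and>
     (\<forall>g\<in>carr L. \<forall>k\<in>carr L. \<Psi> (brk L g k) = brk M (\<Psi> g) (\<Psi> k)) \<and>
     (\<forall>i. \<Psi> ` homog L i = homog M i)"


section \<open>The half-baked Lie superalgebra\<close>

text \<open>
  \<open>hb v\<close> is given by generators and relations: formal Lie expressions in the generators, modulo
  the least congruence \<open>hb_eq v\<close> containing the axioms of a complex Lie superalgebra, the
  linearity of the inclusion of \<open>\<hh>\<close>, and the defining relations.  \<open>Car 0\<close> serves as zero.
\<close>

datatype ('h, 'x) lie_expr =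
    Car 'h
  | E 'x
  | F 'x
  | Add "('h, 'x) lie_expr" "('h, 'x) lie_expr"
  | Scl complex "('h, 'x) lie_expr"
  | Brk "('h, 'x) lie_expr" "('h, 'x) lie_expr"

inductive has_parity ::
    "('h::ab_group_add, 'x) root_data \<Rightarrow> bit \<Rightarrow> ('h, 'x) lie_expr \<Rightarrow> bool" for v where
  "has_parity v 0 (Car h)"
| "has_parity v i (Car 0)"
| "has_parity v (par v x) (E x)"
| "has_parity v (par v x) (F x)"
| "has_parity v i s \<Longrightarrow> has_parity v i t \<Longrightarrow> has_parity v i (Add s t)"
| "has_parity v i s \<Longrightarrow> has_parity v i (Scl c s)"
| "has_parity v i s \<Longrightarrow> has_parity v j t \<Longrightarrow> has_parity v (i + j) (Brk s t)"

definition ksign :: "bit \<Rightarrow> bit \<Rightarrow> complex" where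
  "ksign i j = (if i = 1 \<and> j = 1 then - 1 else 1)"

inductive hb_eq ::
    "('h::ab_group_add, 'x) root_data \<Rightarrow> ('h, 'x) lie_expr \<Rightarrow> ('h, 'x) lie_expr \<Rightarrow> bool" for v where
  hb_refl: "hb_eq v s s"
| hb_sym: "hb_eq v s t \<Longrightarrow> hb_eq v t s"
| hb_trans: "hb_eq v s t \<Longrightarrow> hb_eq v t u \<Longrightarrow> hb_eq v s u"
| cong_add: "hb_eq v s s' \<Longrightarrow> hb_eq v t t' \<Longrightarrow> hb_eq v (Add s t) (Add s' t')"
| cong_scl: "hb_eq v s s' \<Longrightarrow> hb_eq v (Scl c s) (Scl c s')"
| cong_brk: "hb_eq v s s' \<Longrightarrow> hb_eq v t t' \<Longrightarrow> hb_eq v (Brk s t) (Brk s' t')"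
| add_assoc: "hb_eq v (Add (Add s t) u) (Add s (Add t u))"
| add_comm: "hb_eq v (Add s t) (Add t s)"
| add_zero: "hb_eq v (Add s (Car 0)) s"
| add_inv: "hb_eq v (Add s (Scl (- 1) s)) (Car 0)"
| scl_add: "hb_eq v (Scl c (Add s t)) (Add (Scl c s) (Scl c t))"
| add_scl: "hb_eq v (Scl (c + d) s) (Add (Scl c s) (Scl d s))"
| scl_scl: "hb_eq v (Scl c (Scl d s)) (Scl (c * d) s)"
| scl_one: "hb_eq v (Scl 1 s) s"
| brk_add_left: "hb_eq v (Brk (Add s t) u) (Add (Brk s u) (Brk t u))"
| brk_add_right: "hb_eq v (Brk u (Add s t)) (Add (Brk u s) (Brk u t))"
| brk_scl_left: "hb_eq v (Brk (Scl c s) t) (Scl c (Brk s t))"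
| brk_scl_right: "hb_eq v (Brk s (Scl c t)) (Scl c (Brk s t))"
| super_antisym: "has_parity v i s \<Longrightarrow> has_parity v j t \<Longrightarrow>
    hb_eq v (Brk s t) (Scl (- ksign i j) (Brk t s))"
| super_jacobi: "has_parity v i s \<Longrightarrow> has_parity v j t \<Longrightarrow>
    hb_eq v (Brk s (Brk t u)) (Add (Brk (Brk s t) u) (Scl (ksign i j) (Brk t (Brk s u))))"
| car_add: "hb_eq v (Car (h + k)) (Add (Car h) (Car k))"
| car_scl: "hb_eq v (Car (smult v c h)) (Scl c (Car h))"
| rel_hh: "hb_eq v (Brk (Car h) (Car k)) (Car 0)"
| rel_he: "hb_eq v (Brk (Car h) (E x)) (Scl (rt v x h) (E x))"
| rel_hf: "hb_eq v (Brk (Car h) (F x)) (Scl (- rt v x h) (F x))"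
| rel_ef_diff: "x \<noteq> y \<Longrightarrow> hb_eq v (Brk (E x) (F y)) (Car 0)"
| rel_ef_same: "hb_eq v (Brk (E x) (F x)) (Car (cor v x))"

definition hb_cls ::
    "('h::ab_group_add, 'x) root_data \<Rightarrow> ('h, 'x) lie_expr \<Rightarrow> ('h, 'x) lie_expr set" where
  "hb_cls v s = {t. hb_eq v s t}"

definition hb :: "('h::ab_group_add, 'x) root_data \<Rightarrow> ('h, 'x) lie_expr set lsa" where
  "hb v =
     \<lparr>carr = range (hb_cls v),
      zer = hb_cls v (Car 0),
      add = (\<lambda>A B. \<Union>s\<in>A. \<Union>t\<in>B. hb_cls v (Add s t)),
      scl = (\<lambda>c A. \<Union>s\<in>A. hb_cls v (Scl c s)),
      brk = (\<lambda>A B. \<Union>s\<in>A. \<Union>t\<in>B. hb_cls v (Brk s t)),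
      homog = (\<lambda>i. hb_cls v ` {s. has_parity v i s})\<rparr>"

text \<open>
  In \<open>admissible\<close>, \<open>I v \<inter> \<hh>(v) = 0\<close> is read through the embedding \<open>h \<mapsto> hb_cls v (Car h)\<close> of
  \<open>\<hh>(v)\<close> into \<open>hb v\<close>.
\<close>

definition admissible :: "('h::ab_group_add, 'x::finite) root_data set \<Rightarrow> bool" where
  "admissible R \<longleftrightarrow> (\<exists>I.
     (\<forall>v\<in>R. graded_ideal (hb v) (I v) \<and> (\<forall>h. hb_cls v (Car h) \<in> I v \<longrightarrow> h = 0)) \<and>
     (\<forall>v\<in>R. \<forall>v' \<phi>. arrow v v' \<phi> \<longrightarrow>
        (\<exists>\<Psi>. lsa_iso (quotient_lsa (hb v) (I v)) (quotient_lsa (hb v') (I v')) \<Psi> \<and>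
             (\<forall>h. \<Psi> (coset (hb v) (I v) (hb_cls v (Car h))) =
                  coset (hb v') (I v') (hb_cls v' (Car (\<phi> h)))))))"


section \<open>Skeleton, spine, real roots and Weyl group\<close>

inductive_set Sk :: "('h::ab_group_add, 'x) root_data \<Rightarrow> ('h, 'x) root_data set" for v where
  Sk_base: "v \<in> Sk v"
| Sk_step: "u \<in> Sk v \<Longrightarrow> reflectable u x \<Longrightarrow> reflexion u x \<in> Sk v"

inductive_set Sp :: "('h::ab_group_add, 'x) root_data \<Rightarrow> ('h, 'x) root_data set" for v where
  Sp_base: "v \<in> Sp v"
| Sp_step: "u \<in> Sp v \<Longrightarrow> reflectable u x \<Longrightarrow> cartan u x x = 0 \<Longrightarrow> reflexion u x \<in> Sp v"

definition anisotropic_at :: "('h, 'x) root_data \<Rightarrow> 'x \<Rightarrow> bool" where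
  "anisotropic_at u x \<longleftrightarrow> reflectable u x \<and> cartan u x x \<noteq> 0"

definition anisotropic_roots ::
    "('h::ab_group_add, 'x) root_data \<Rightarrow> ('h \<Rightarrow> complex) set" where
  "anisotropic_roots v = {rt u x | u x. u \<in> Sk v \<and> anisotropic_at u x}"

definition coroot :: "('h::ab_group_add, 'x) root_data \<Rightarrow> ('h \<Rightarrow> complex) \<Rightarrow> 'h" where
  "coroot v \<alpha> = (THE c. \<exists>u\<in>Sk v. \<exists>x. anisotropic_at u x \<and> rt u x = \<alpha> \<and>
                    c = smult u (2 / cartan u x x) (cor u x))"

definition root_reflection ::
    "('h::ab_group_add, 'x) root_data \<Rightarrow> ('h \<Rightarrow> complex) \<Rightarrow> 'h \<Rightarrow> 'h" where
  "root_reflection v \<alpha> h = h - smult v (\<alpha> h) (coroot v \<alpha>)"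

inductive_set weyl_group :: "('h::ab_group_add, 'x) root_data \<Rightarrow> ('h \<Rightarrow> 'h) set" for v where
  weyl_id: "id \<in> weyl_group v"
| weyl_gen: "\<alpha> \<in> anisotropic_roots v \<Longrightarrow> root_reflection v \<alpha> \<in> weyl_group v"
| weyl_comp: "w \<in> weyl_group v \<Longrightarrow> w' \<in> weyl_group v \<Longrightarrow> w \<circ> w' \<in> weyl_group v"
| weyl_inv: "w \<in> weyl_group v \<Longrightarrow> inv w \<in> weyl_group v"

text \<open>The group \<open>GL(\<hh>)\<close> acts on the dual space by \<open>w(\<beta>) = \<beta> \<circ> w\<^sup>-\<^sup>1\<close>.\<close>

definition weyl_act ::
    "('h \<Rightarrow> 'h) \<Rightarrow> ('h, 'x) root_data \<Rightarrow> ('h, 'x) root_data" where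
  "weyl_act w u = u\<lparr>cor := \<lambda>y. w (cor u y), rt := \<lambda>y. rt u y \<circ> inv w\<rparr>"

definition principal_roots ::
    "('h::ab_group_add, 'x) root_data \<Rightarrow> ('h \<Rightarrow> complex) set" where
  "principal_roots v = anisotropic_roots v \<inter> {rt u x | u x. u \<in> Sp v}"

definition weyl_length :: "('h::ab_group_add, 'x) root_data \<Rightarrow> ('h \<Rightarrow> 'h) \<Rightarrow> nat" where
  "weyl_length v w = (LEAST n. \<exists>\<alpha>s. length \<alpha>s = n \<and> set \<alpha>s \<subseteq> principal_roots v \<and>
                         w = foldr (\<lambda>\<alpha> f. root_reflection v \<alpha> \<circ> f) \<alpha>s id)"

text \<open>\<open>positive_anisotropic v u\<close> is \<open>\<Delta>\<^sup>+\<^sub>a\<^sub>n(u)\<close> for \<open>u \<in> Sk v\<close>.\<close>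

definition positive_anisotropic ::
    "('h::ab_group_add, 'x::finite) root_data \<Rightarrow> ('h, 'x) root_data \<Rightarrow> ('h \<Rightarrow> complex) set" where
  "positive_anisotropic v u =
     {\<alpha> \<in> anisotropic_roots v. \<exists>n :: 'x \<Rightarrow> nat. \<alpha> = (\<lambda>h. \<Sum>x\<in>UNIV. of_nat (n x) * rt u x h)}"

end

(* Fix v and pass from the half-baked superalgebras to the quotients g(u) given by admissibility.
   By the triangular decomposition every weight of g(u) is a non-negative or non-positive
   combination of the b_u(x), and the weight spaces of b_u(x) and -b_u(x) are spanned by e_x and
   f_x.  As all g(u), u in Sk(v), are isomorphic over h, every real root is positive or negative
   at every vertex of Sk(v), and a real root determines its coroot [e_x, f_x] up to a scalar.

   The rest is combinatorics.  Passing from u to r_x(u), or to s_\<alpha>(u) with \<alpha> = b_u(x), changes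
   the b_u(y) only by multiples of b_u(x), so it can change the sign of an anisotropic root only
   if this root is +b_u(x) or -b_u(x).  Hence the set P of positive anisotropic roots is constant
   on Sp(v), and the reflection in a principal root \<alpha> permutes P - {\<alpha>}.  The exchange condition
   then shows that the length of w is the number of roots \<beta> in P with w\<^sup>-\<^sup>1 \<beta> not in P. *)

theory Submission
  imports Defs
begin

subsection \<open>Vector space operations on congruence classes\<close>

text \<open>The superalgebras only have to yield two facts about vertices u, u' of the skeleton:
  every b_u(x) has coefficients of one sign over the family b_u', and equal real roots have
  proportional coroots. For this, spanning by triangular words is enough: an eigenvalue argument
  separates weights, and since the b(x) are independent, e_x or f_x is the only word of its weight.
  The obstacle is that elements are formal expressions and that the Jacobi identity is given only
  for homogeneous ones, so the left factor of a bracket is split into an even and an odd part.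

  A root whose sign changes under a shift by multiples of b_u(x) has no other coefficient, hence is
  an integral multiple of b_u(x); comparison with a vertex where the root itself is simple leaves
  only the factor 1 or -1.

  The factorization v' = w(v'') exists because W commutes with reflexions: a reflexion of w(v'')
  either moves v'' along the spine or appends a principal reflection to w. It is unique because an
  element of W carrying one spine vertex to another preserves P, so it inverts nothing and is given
  by the empty word.\<close>

locale lie_congruence =
  fixes v :: "('h::ab_group_add, 'x::finite) root_data"
    and R :: "('h, 'x) lie_expr \<Rightarrow> ('h, 'x) lie_expr \<Rightarrow> bool"  (infix "\<approx>" 50)
  assumes hb: "hb_eq v s t \<Longrightarrow> s \<approx> t"
    and sym: "s \<approx> t \<Longrightarrow> t \<approx> s"
    and trans: "s \<approx> t \<Longrightarrow> t \<approx> u \<Longrightarrow> s \<approx> u"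
    and cong_add: "s \<approx> s' \<Longrightarrow> t \<approx> t' \<Longrightarrow> Add s t \<approx> Add s' t'"
    and cong_scl: "s \<approx> s' \<Longrightarrow> Scl c s \<approx> Scl c s'"
    and cong_brk: "s \<approx> s' \<Longrightarrow> t \<approx> t' \<Longrightarrow> Brk s t \<approx> Brk s' t'"
begin

text \<open>The congruence stays abstract because it has two instances, \<open>hb_eq v\<close>
  itself and congruence modulo an ideal; one calculus then serves the half-baked algebra and its
  quotients.\<close>

definition cls :: "('h, 'x) lie_expr \<Rightarrow> ('h, 'x) lie_expr set" where
  "cls s = {t. s \<approx> t}"

lemma refl: "s \<approx> s"
  by (rule hb) (rule hb_refl)

lemma cls_eq_iff: "cls s = cls t \<longleftrightarrow> s \<approx> t"
  unfolding cls_def using refl sym trans by blast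

text \<open>Unions over all representatives, as in the record \<open>hb\<close>. On arbitrary sets
  associativity and commutativity hold without side condition and can be used for rewriting;
  \<open>scale_add\<close> and the unit laws are stated for classes.\<close>

definition plus :: "('h, 'x) lie_expr set \<Rightarrow> ('h, 'x) lie_expr set \<Rightarrow> ('h, 'x) lie_expr set" where
  "plus A B = (\<Union>s\<in>A. \<Union>t\<in>B. cls (Add s t))"

definition scale :: "complex \<Rightarrow> ('h, 'x) lie_expr set \<Rightarrow> ('h, 'x) lie_expr set" where
  "scale c A = (\<Union>s\<in>A. cls (Scl c s))"

lemma mem_cls: "t \<in> cls s \<longleftrightarrow> s \<approx> t"
  by (simp add: cls_def)

lemma cls_hb: "hb_eq v s t \<Longrightarrow> cls s = cls t"
  by (simp add: cls_eq_iff hb)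

text \<open>By reflexivity the class is nonempty, so a union of equal sets is that set. This reduces
  operations on sets to operations on representatives.\<close>

lemma UN_cls:
  assumes "\<And>t. s \<approx> t \<Longrightarrow> f t = f s"
  shows "(\<Union>t\<in>cls s. f t) = f s"
proof
  show "(\<Union>t\<in>cls s. f t) \<subseteq> f s"
    by (rule UN_least) (use assms in \<open>simp add: mem_cls\<close>)
  show "f s \<subseteq> (\<Union>t\<in>cls s. f t)"
    by (rule UN_upper) (simp add: mem_cls refl)
qed

lemma cls_Add_cong: "s \<approx> s' \<Longrightarrow> t \<approx> t' \<Longrightarrow> cls (Add s' t') = cls (Add s t)"
  unfolding cls_eq_iff by (rule sym) (rule cong_add)

lemma cls_Scl_cong: "s \<approx> s' \<Longrightarrow> cls (Scl c s') = cls (Scl c s)"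
  unfolding cls_eq_iff by (rule sym) (rule cong_scl)

lemma cls_Add: "cls (Add s t) = plus (cls s) (cls t)"
proof -
  have "plus (cls s) (cls t) = (\<Union>s'\<in>cls s. cls (Add s' t))"
    unfolding plus_def by (intro SUP_cong HOL.refl UN_cls) (rule cls_Add_cong; simp add: refl)
  also have "\<dots> = cls (Add s t)"
    by (intro UN_cls) (rule cls_Add_cong; simp add: refl)
  finally show ?thesis by (rule HOL.sym)
qed

lemma cls_Scl: "cls (Scl c s) = scale c (cls s)"
  unfolding scale_def by (rule UN_cls [symmetric]) (erule cls_Scl_cong)

lemma plus_assoc: "plus (plus A B) C = plus A (plus B C)"
proof -
  have "plus (plus A B) C = (\<Union>s\<in>A. \<Union>t\<in>B. \<Union>u\<in>C. \<Union>x\<in>cls (Add s t). cls (Add x u))"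
    unfolding plus_def by blast
  also have "\<dots> = (\<Union>s\<in>A. \<Union>t\<in>B. \<Union>u\<in>C. cls (Add (Add s t) u))"
    by (intro SUP_cong HOL.refl UN_cls) (rule cls_Add_cong; simp add: refl)
  also have "\<dots> = (\<Union>s\<in>A. \<Union>t\<in>B. \<Union>u\<in>C. cls (Add s (Add t u)))"
    by (intro SUP_cong HOL.refl cls_hb add_assoc)
  also have "\<dots> = (\<Union>s\<in>A. \<Union>t\<in>B. \<Union>u\<in>C. \<Union>x\<in>cls (Add t u). cls (Add s x))"
    by (intro SUP_cong HOL.refl UN_cls [symmetric]) (rule cls_Add_cong; simp add: refl)
  also have "\<dots> = plus A (plus B C)"
    unfolding plus_def by blast
  finally show ?thesis .
qed

lemma plus_comm: "plus A B = plus B A"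
proof -
  have "cls (Add s t) = cls (Add t s)" for s t by (rule cls_hb [OF add_comm])
  then show ?thesis unfolding plus_def by blast
qed

lemma plus_left_comm: "plus A (plus B C) = plus B (plus A C)"
  by (metis plus_assoc plus_comm)

lemma scale_plus: "scale c (plus A B) = plus (scale c A) (scale c B)"
proof -
  have "scale c (plus A B) = (\<Union>s\<in>A. \<Union>t\<in>B. \<Union>x\<in>cls (Add s t). cls (Scl c x))"
    unfolding plus_def scale_def by blast
  also have "\<dots> = (\<Union>s\<in>A. \<Union>t\<in>B. cls (Scl c (Add s t)))"
    by (intro SUP_cong HOL.refl UN_cls) (erule cls_Scl_cong)
  also have "\<dots> = (\<Union>s\<in>A. \<Union>t\<in>B. plus (cls (Scl c s)) (cls (Scl c t)))"
    by (intro SUP_cong HOL.refl) (simp add: cls_Add [symmetric] cls_hb scl_add)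
  also have "\<dots> = plus (scale c A) (scale c B)"
    unfolding plus_def scale_def by blast
  finally show ?thesis .
qed

lemma scale_scale: "scale c (scale d A) = scale (c * d) A"
proof -
  have "scale c (scale d A) = (\<Union>s\<in>A. scale c (cls (Scl d s)))"
    unfolding scale_def by blast
  also have "\<dots> = scale (c * d) A"
    unfolding scale_def [of _ A] by (intro SUP_cong HOL.refl) (metis cls_Scl cls_hb scl_scl)
  finally show ?thesis .
qed

lemma scale_add: "scale (c + d) (cls s) = plus (scale c (cls s)) (scale d (cls s))"
  by (metis cls_Add cls_Scl cls_hb add_scl)

lemma scale_one: "scale 1 (cls s) = cls s"
  by (metis cls_Scl cls_hb scl_one)

lemma plus_zero: "plus (cls s) (cls (Car 0)) = cls s"
  by (metis cls_Add cls_hb add_zero)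

lemma plus_inv: "plus (cls s) (scale (- 1) (cls s)) = cls (Car 0)"
  by (metis cls_Add cls_Scl cls_hb add_inv)

text \<open>The axioms do not mention the scalar 0 directly; it is written as 1 + (-1).\<close>

lemma scale_0: "scale 0 (cls s) = cls (Car 0)"
  using scale_add [of 1 "-1" s] by (simp add: scale_one plus_inv)

lemma scale_zero: "scale c (cls (Car 0)) = cls (Car 0)"
  by (metis scale_0 scale_scale mult_zero_right)

lemma cls_Brk_Add_left: "cls (Brk (Add s t) u) = plus (cls (Brk s u)) (cls (Brk t u))"
  by (metis cls_Add cls_hb brk_add_left)

lemma cls_Brk_Add_right: "cls (Brk u (Add s t)) = plus (cls (Brk u s)) (cls (Brk u t))"
  by (metis cls_Add cls_hb brk_add_right)

lemma cls_Brk_Scl_left: "cls (Brk (Scl c s) t) = scale c (cls (Brk s t))"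
  by (metis cls_Scl cls_hb brk_scl_left)

lemma cls_Brk_Scl_right: "cls (Brk s (Scl c t)) = scale c (cls (Brk s t))"
  by (metis cls_Scl cls_hb brk_scl_right)

lemma cls_Brk_cong: "cls s = cls s' \<Longrightarrow> cls t = cls t' \<Longrightarrow> cls (Brk s t) = cls (Brk s' t')"
  by (simp add: cls_eq_iff cong_brk)

lemma cls_Brk_zero_left: "cls (Brk (Car 0) t) = cls (Car 0)"
proof -
  have "cls (Brk (Car 0) t) = cls (Brk (Scl 0 (Car 0)) t)"
    by (rule cls_Brk_cong) (simp_all add: cls_Scl scale_0)
  then show ?thesis by (simp add: cls_Brk_Scl_left scale_0)
qed

lemma cls_Brk_zero_right: "cls (Brk t (Car 0)) = cls (Car 0)"
proof -
  have "cls (Brk t (Car 0)) = cls (Brk t (Scl 0 (Car 0)))"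
    by (rule cls_Brk_cong) (simp_all add: cls_Scl scale_0)
  then show ?thesis by (simp add: cls_Brk_Scl_right scale_0)
qed

lemma zero_plus: "plus (cls (Car 0)) (cls s) = cls s"
  by (simp add: plus_comm plus_zero)

lemmas linear_simps = cls_Add cls_Scl scale_plus scale_scale scale_one
  plus_zero zero_plus plus_inv scale_0 scale_zero cls_Brk_Add_left cls_Brk_Add_right
  cls_Brk_Scl_left cls_Brk_Scl_right cls_Brk_zero_left cls_Brk_zero_right

lemma scale_cancel:
  assumes "scale c (cls s) = cls (Car 0)" "c \<noteq> 0" shows "cls s = cls (Car 0)"
proof -
  have "cls s = scale (inverse c) (scale c (cls s))"
    using assms(2) by (simp add: scale_scale scale_one)
  then show ?thesis by (simp add: assms(1) scale_zero)
qed

lemma cls_antisym: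
  "has_parity v i s \<Longrightarrow> has_parity v j t \<Longrightarrow> cls (Brk s t) = scale (- ksign i j) (cls (Brk t s))"
  by (metis cls_Scl cls_hb super_antisym)

lemma cls_jacobi:
  "has_parity v i s \<Longrightarrow> has_parity v j t \<Longrightarrow> cls (Brk s (Brk t u)) =
     plus (cls (Brk (Brk s t) u)) (scale (ksign i j) (cls (Brk t (Brk s u))))"
  by (metis cls_Scl cls_Add cls_hb super_jacobi)

subsection \<open>Weight vectors\<close>

text \<open>Weight vectors may be zero: the class of \<open>Car 0\<close> has every weight.\<close>

definition weight :: "('h \<Rightarrow> complex) \<Rightarrow> ('h, 'x) lie_expr \<Rightarrow> bool" where
  "weight \<beta> s \<longleftrightarrow> (\<forall>h. cls (Brk (Car h) s) = scale (\<beta> h) (cls s))"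

inductive weight_span :: "('h \<Rightarrow> complex) set \<Rightarrow> ('h, 'x) lie_expr \<Rightarrow> bool" for S where
  span_base: "weight \<beta> t \<Longrightarrow> \<beta> \<in> S \<Longrightarrow> weight_span S t"
| span_zero: "weight_span S (Car 0)"
| span_Add: "weight_span S s \<Longrightarrow> weight_span S t \<Longrightarrow> weight_span S (Add s t)"
| span_cong: "weight_span S s \<Longrightarrow> cls s = cls t \<Longrightarrow> weight_span S t"

lemma weight_cong: "weight \<beta> s \<Longrightarrow> cls s = cls t \<Longrightarrow> weight \<beta> t"
  unfolding weight_def by (metis cls_Brk_cong)

lemma weight_Scl: "weight \<beta> s \<Longrightarrow> weight \<beta> (Scl c s)"
  by (simp add: weight_def linear_simps mult.commute)

lemma weight_Add: "weight \<beta> s \<Longrightarrow> weight \<beta> t \<Longrightarrow> weight \<beta> (Add s t)"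
  by (simp add: weight_def linear_simps)

lemma span_Scl: "weight_span S s \<Longrightarrow> weight_span S (Scl c s)"
proof (induction rule: weight_span.induct)
  case (span_base \<beta> t)
  then show ?case by (metis weight_Scl weight_span.span_base)
next
  case span_zero
  show ?case by (rule span_cong [OF weight_span.span_zero]) (simp add: linear_simps)
next
  case (span_Add s t)
  show ?case
    by (rule span_cong [OF weight_span.span_Add [OF span_Add.IH]]) (simp add: linear_simps)
next
  case (span_cong s t)
  show ?case
    by (rule weight_span.span_cong [OF span_cong.IH]) (simp add: linear_simps span_cong.hyps)
qed

lemma span_mono: "weight_span S s \<Longrightarrow> S \<subseteq> T \<Longrightarrow> weight_span T s"
  by (induction rule: weight_span.induct)
    (blast intro: weight_span.intros)+

lemma span_finite: "weight_span S s \<Longrightarrow> \<exists>F\<subseteq>S. finite F \<and> weight_span F s"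
proof (induction rule: weight_span.induct)
  case (span_base \<beta> t)
  then show ?case by (intro exI [of _ "{\<beta>}"]) (auto intro: weight_span.span_base)
next
  case span_zero
  show ?case by (blast intro: weight_span.span_zero)
next
  case (span_Add s t)
  then obtain F G where "F \<subseteq> S" "finite F" "weight_span F s" "G \<subseteq> S" "finite G" "weight_span G t"
    by blast
  then show ?case
    by (intro exI [of _ "F \<union> G"]) (auto intro!: weight_span.span_Add elim: span_mono)
next
  case (span_cong s t)
  then show ?case by (blast intro: weight_span.span_cong)
qed

text \<open>The operator "bracket with h minus \<open>\<beta> h\<close>" kills weight \<beta> and
  multiplies a vector of weight \<gamma> by \<open>\<gamma> h - \<beta> h\<close>. So it removes one
  weight from a sum and creates no new one.\<close>

lemma span_shift:
  "weight_span (insert \<beta> S) t \<Longrightarrow> weight_span S (Add (Brk (Car h) t) (Scl (- \<beta> h) t))"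
proof (induction rule: weight_span.induct)
  case (span_base \<gamma> t)
  have eq: "cls (Scl (\<gamma> h - \<beta> h) t) = cls (Add (Brk (Car h) t) (Scl (- \<beta> h) t))"
    using span_base(1) scale_add [of "\<gamma> h" "- \<beta> h" t] by (simp add: weight_def linear_simps)
  show ?case
  proof (cases "\<gamma> = \<beta>")
    case True
    show ?thesis
      by (rule span_cong [OF span_zero]) (use eq in \<open>simp add: True linear_simps\<close>)
  next
    case False
    then show ?thesis
      using span_base by (metis eq span_cong weight_span.span_base weight_Scl insertE)
  qed
next
  case span_zero
  show ?case by (rule span_cong [OF weight_span.span_zero]) (simp add: linear_simps)
next
  case (span_Add s t)
  show ?case
    by (rule span_cong [OF weight_span.span_Add [OF span_Add.IH]])
      (simp add: linear_simps plus_assoc plus_left_comm)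
next
  case (span_cong s t)
  show ?case
    by (rule weight_span.span_cong [OF span_cong.IH])
      (simp add: linear_simps span_cong.hyps cls_Brk_cong [OF HOL.refl span_cong.hyps(2)])
qed

text \<open>Independence of weight spaces. Only finitely many weights occur in t; choosing h that
  separates \<alpha> from one of them, \<beta>, the shift operator removes \<beta> and multiplies t
  by the nonzero number \<open>\<alpha> h - \<beta> h\<close>, which is cancelled at the
  end.\<close>

lemma weight_not_in_span:
  assumes "weight_span S t" "weight \<alpha> t" "\<alpha> \<notin> S"
  shows "cls t = cls (Car 0)"
proof -
  obtain F where F: "finite F" "weight_span F t" "F \<subseteq> S"
    using span_finite [OF assms(1)] by blast
  from F(3) assms(3) have "\<alpha> \<notin> F" by blast
  with F(1,2) show ?thesis using assms(2)
  proof (induction F arbitrary: t rule: finite_induct)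
    case empty
    have "weight_span {} t \<Longrightarrow> cls t = cls (Car 0)" for t
      by (induction rule: weight_span.induct) (auto simp: linear_simps)
    then show ?case using empty by blast
  next
    case (insert \<beta> F)
    then obtain h where h: "\<alpha> h \<noteq> \<beta> h" by (metis ext insertI1)
    have "cls (Add (Brk (Car h) t) (Scl (- \<beta> h) t)) = cls (Scl (\<alpha> h - \<beta> h) t)"
      using insert.prems(3) scale_add [of "\<alpha> h" "- \<beta> h" t] by (simp add: weight_def linear_simps)
    then have "weight_span F (Scl (\<alpha> h - \<beta> h) t)"
      using span_shift [OF insert.prems(1)] span_cong by blast
    then have "cls (Scl (\<alpha> h - \<beta> h) t) = cls (Car 0)"
      using insert.IH insert.prems weight_Scl by blast
    then have "scale (\<alpha> h - \<beta> h) (cls t) = cls (Car 0)"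
      by (simp add: cls_Scl)
    then show ?case by (rule scale_cancel) (use h in simp)
  qed
qed

text \<open>The Jacobi identity for \<open>Car h\<close>, s and t. It carries no sign because
  \<open>Car h\<close> is even, and it asks for a parity of s but not of t.\<close>

lemma weight_Brk:
  assumes "has_parity v j s" "weight \<beta> s" "weight \<gamma> t"
  shows "weight (\<lambda>h. \<beta> h + \<gamma> h) (Brk s t)"
  unfolding weight_def
proof
  fix h
  have "cls (Brk (Brk (Car h) s) t) = scale (\<beta> h) (cls (Brk s t))"
    by (metis assms(2) weight_def cls_Brk_cong cls_Scl cls_Brk_Scl_left)
  moreover have "cls (Brk s (Brk (Car h) t)) = scale (\<gamma> h) (cls (Brk s t))"
    by (metis assms(3) weight_def cls_Brk_cong cls_Scl cls_Brk_Scl_right)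
  ultimately show "cls (Brk (Car h) (Brk s t)) = scale (\<beta> h + \<gamma> h) (cls (Brk s t))"
    using cls_jacobi [OF has_parity.intros(1) assms(1), of h t]
    by (simp add: ksign_def scale_add scale_scale)
qed

lemma weight_Car: "weight (\<lambda>_. 0) (Car h)"
  using cls_hb [OF rel_hh] by (simp add: weight_def linear_simps)

subsection \<open>Triangular decomposition\<close>

text \<open>The sign \<open>True\<close> stands for \<open>\<nn>\<^sup>+\<close>, the sign \<open>False\<close> for \<open>\<nn>\<^sup>-\<close>.\<close>

definition gen :: "bool \<Rightarrow> 'x \<Rightarrow> ('h, 'x) lie_expr" where
  "gen \<sigma> x = (if \<sigma> then E x else F x)"

text \<open>Right-normed brackets. The innermost letter is kept apart so that every word is
  nonempty.\<close>

primrec word :: "bool \<Rightarrow> 'x list \<Rightarrow> 'x \<Rightarrow> ('h, 'x) lie_expr" where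
  "word \<sigma> [] y = gen \<sigma> y"
| "word \<sigma> (x # xs) y = Brk (gen \<sigma> x) (word \<sigma> xs y)"

definition word_weight :: "bool \<Rightarrow> 'x list \<Rightarrow> 'x \<Rightarrow> 'h \<Rightarrow> complex" where
  "word_weight \<sigma> xs y h = (if \<sigma> then 1 else - 1) * (\<Sum>x\<leftarrow>y # xs. rt v x h)"

lemma has_parity_gen: "has_parity v (par v x) (gen \<sigma> x)"
  by (simp add: gen_def has_parity.intros)

lemma weight_gen: "weight (\<lambda>h. (if \<sigma> then 1 else - 1) * rt v x h) (gen \<sigma> x)"
  using cls_hb [OF rel_he] cls_hb [OF rel_hf] by (simp add: weight_def gen_def linear_simps)

lemma weight_word: "weight (word_weight \<sigma> xs y) (word \<sigma> xs y)"
proof (induction xs)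
  case Nil
  then show ?case
    using weight_gen by (simp add: word_weight_def [abs_def])
next
  case (Cons x xs)
  have "word_weight \<sigma> (x # xs) y
      = (\<lambda>h. (if \<sigma> then 1 else - 1) * rt v x h + word_weight \<sigma> xs y h)"
    by (auto simp: word_weight_def algebra_simps)
  then show ?case
    using weight_Brk [OF has_parity_gen weight_gen Cons] by simp
qed

text \<open>The relations give the brackets of E with F; the other order follows by antisymmetry up
  to a scalar, which \<open>Car\<close> absorbs.\<close>

lemma gen_opposite: "\<exists>k. cls (Brk (gen (\<not> \<sigma>) x) (gen \<sigma> y)) = cls (Car k)"
proof -
  have EF: "\<exists>k. cls (Brk (E x) (F y)) = cls (Car k)" for x y
    using cls_hb [OF rel_ef_same] cls_hb [OF rel_ef_diff] by (cases "x = y") blast+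
  have scale_Car: "\<exists>k'. scale c (cls (Car k)) = cls (Car k')" for c k
    by (metis cls_Scl cls_hb car_scl)
  show ?thesis
  proof (cases \<sigma>)
    case True
    obtain k where "cls (Brk (E y) (F x)) = cls (Car k)" using EF by blast
    then have "cls (Brk (F x) (E y)) = scale (- ksign (par v x) (par v y)) (cls (Car k))"
      using cls_antisym [OF has_parity.intros(4) has_parity.intros(3), of x y] by simp
    then show ?thesis using scale_Car True by (simp add: gen_def)
  next
    case False
    then show ?thesis using EF by (simp add: gen_def)
  qed
qed

text \<open>For a singleton \<Sigma> this is the Borel part, the Cartan space plus one nilpotent
  half; for \<open>UNIV\<close> it is the sum of all three pieces, with no claim that the sum is
  direct.\<close>

inductive triangular :: "bool set \<Rightarrow> ('h, 'x) lie_expr \<Rightarrow> bool" for \<Sigma> where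
  tri_Car: "triangular \<Sigma> (Car h)"
| tri_word: "\<sigma> \<in> \<Sigma> \<Longrightarrow> triangular \<Sigma> (word \<sigma> xs y)"
| tri_Add: "triangular \<Sigma> s \<Longrightarrow> triangular \<Sigma> t \<Longrightarrow> triangular \<Sigma> (Add s t)"
| tri_Scl: "triangular \<Sigma> s \<Longrightarrow> triangular \<Sigma> (Scl c s)"
| tri_cong: "triangular \<Sigma> s \<Longrightarrow> cls s = cls t \<Longrightarrow> triangular \<Sigma> t"

lemma tri_mono: "triangular \<Sigma> s \<Longrightarrow> \<Sigma> \<subseteq> T \<Longrightarrow> triangular T s"
proof (induction rule: triangular.induct)
  case (tri_cong s t)
  then show ?case using triangular.tri_cong by blast
qed (auto intro: tri_Car tri_word tri_Add tri_Scl)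

lemma tri_Brk_linear:
  assumes "triangular \<Sigma> t"
    and Car: "\<And>h. triangular T (Brk s (Car h))"
    and word: "\<And>\<sigma> xs y. \<sigma> \<in> \<Sigma> \<Longrightarrow> triangular T (Brk s (word \<sigma> xs y))"
  shows "triangular T (Brk s t)"
  using assms(1)
proof (induction rule: triangular.induct)
  case (tri_Add t u)
  show ?case
    by (rule tri_cong [OF triangular.tri_Add [OF tri_Add.IH]]) (simp add: linear_simps)
next
  case (tri_Scl t c)
  show ?case
    by (rule tri_cong [OF triangular.tri_Scl [OF tri_Scl.IH, of c]]) (simp add: linear_simps)
next
  case (tri_cong t u)
  then show ?case using cls_Brk_cong [OF HOL.refl] triangular.tri_cong by blast
qed (use Car word in auto)

lemma tri_weight: "weight \<beta> s \<Longrightarrow> triangular \<Sigma> s \<Longrightarrow> triangular \<Sigma> (Brk (Car h) s)"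
  by (metis cls_Scl tri_Scl tri_cong weight_def)

lemma tri_Brk_Car: "triangular \<Sigma> t \<Longrightarrow> triangular \<Sigma> (Brk (Car h) t)"
  by (erule tri_Brk_linear) (auto intro: tri_weight weight_Car weight_word tri_Car tri_word)

lemma tri_gen_Car: "\<sigma> \<in> \<Sigma> \<Longrightarrow> triangular \<Sigma> (Brk (gen \<sigma> x) (Car h))"
proof -
  assume "\<sigma> \<in> \<Sigma>"
  then have "triangular \<Sigma> (gen \<sigma> x)" by (metis tri_word word.simps(1))
  then have "triangular \<Sigma> (Scl (- ksign (par v x) 0) (Brk (Car h) (gen \<sigma> x)))"
    by (intro tri_Scl tri_weight [OF weight_gen])
  then show ?thesis
    by (rule tri_cong)
      (simp add: cls_antisym [OF has_parity_gen has_parity.intros(1)] cls_Scl)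
qed

lemma tri_gen_same: "triangular {\<sigma>} t \<Longrightarrow> triangular {\<sigma>} (Brk (gen \<sigma> x) t)"
  by (erule tri_Brk_linear) (metis tri_gen_Car tri_word word.simps(2) singletonD insertI1)+

text \<open>Jacobi turns [g,[z,t]] into [[g,z],t], where [g,z] lies in the Cartan space, and a
  multiple of [z,[g,t]]. The claim is confined to the Borel part of sign \<sigma> so that the second
  term needs only \<open>tri_gen_same\<close>; with both signs allowed, the bracket with z would
  again meet words of the opposite sign.\<close>

lemma tri_gen_opposite: "triangular {\<sigma>} (Brk (gen (\<not> \<sigma>) x) (word \<sigma> xs y))"
proof (induction xs)
  case Nil
  then show ?case by (metis gen_opposite tri_Car tri_cong word.simps(1))
next
  case (Cons z zs)
  let ?g = "gen (\<not> \<sigma>) x" and ?t = "word \<sigma> zs y"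
  obtain k where "cls (Brk ?g (gen \<sigma> z)) = cls (Car k)" using gen_opposite by blast
  then have "triangular {\<sigma>} (Brk (Brk ?g (gen \<sigma> z)) ?t)"
    by (metis cls_Brk_cong tri_cong tri_Brk_Car tri_word singletonI)
  moreover have "triangular {\<sigma>} (Scl (ksign (par v x) (par v z)) (Brk (gen \<sigma> z) (Brk ?g ?t)))"
    using Cons by (intro tri_Scl tri_gen_same)
  ultimately show ?case
    by (rule tri_cong [OF tri_Add])
      (simp add: linear_simps cls_jacobi [OF has_parity_gen has_parity_gen, of \<open>\<not> \<sigma>\<close> x \<sigma> z])
qed

lemma tri_gen: "triangular UNIV t \<Longrightarrow> triangular UNIV (Brk (gen \<sigma> x) t)"
proof (erule tri_Brk_linear)
  fix \<tau> xs y
  show "triangular UNIV (Brk (gen \<sigma> x) (word \<tau> xs y))"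
  proof (cases "\<tau> = \<sigma>")
    case True
    then show ?thesis using tri_word [of \<sigma> UNIV "x # xs" y] by simp
  next
    case False
    then have "\<sigma> = (\<not> \<tau>)" by simp
    then show ?thesis using tri_mono [OF tri_gen_opposite subset_UNIV] by simp
  qed
qed (simp add: tri_gen_Car)

text \<open>The expressions whose bracket preserves the triangular span contain the generators and
  are closed under brackets, since Jacobi expresses [[s,s'],t] through [s,[s',t]] and [s',[s,t]].
  The induction runs over parity derivations because Jacobi needs the parities of s and s'.\<close>

lemma tri_homogeneous:
  "has_parity v i s \<Longrightarrow> triangular UNIV t \<Longrightarrow> triangular UNIV (Brk s t)"
proof (induction arbitrary: t rule: has_parity.induct)
  case (1 h)
  then show ?case by (rule tri_Brk_Car)
next
  case (2 i)
  then show ?case by (simp add: tri_Brk_Car)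
next
  case (3 x)
  then show ?case using tri_gen [of t True x] by (simp add: gen_def)
next
  case (4 x)
  then show ?case using tri_gen [of t False x] by (simp add: gen_def)
next
  case (5 i s s')
  show ?case
    by (rule tri_cong [OF tri_Add [OF "5.IH" [OF "5.prems"]]]) (simp add: linear_simps)
next
  case (6 i s c)
  show ?case
    by (rule tri_cong [OF tri_Scl [OF "6.IH" [OF "6.prems"], of c]]) (simp add: linear_simps)
next
  case (7 i s j s')
  let ?k = "ksign i j"
  have "triangular UNIV (Add (Brk s (Brk s' t)) (Scl (- ?k) (Brk s' (Brk s t))))"
    using 7 by (intro tri_Add tri_Scl) auto
  moreover have "cls (Add (Brk s (Brk s' t)) (Scl (- ?k) (Brk s' (Brk s t))))
      = cls (Brk (Brk s s') t)"
  proof -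
    have "plus (scale ?k (cls (Brk s' (Brk s t)))) (scale (- ?k) (cls (Brk s' (Brk s t))))
        = cls (Car 0)"
      by (simp add: scale_add [symmetric] scale_0)
    then show ?thesis
      by (simp add: linear_simps cls_jacobi [OF "7.hyps"] plus_assoc)
  qed
  ultimately show ?case by (rule tri_cong)
qed

text \<open>Needed because a formal sum may mix parities, while Jacobi and antisymmetry are axioms
  for homogeneous expressions only.\<close>

lemma ex_homogeneous:
  "\<exists>s0 s1. has_parity v 0 s0 \<and> has_parity v 1 s1 \<and> cls s = cls (Add s0 s1)"
proof (induction s)
  case (Car h)
  have "cls (Car h) = cls (Add (Car h) (Car 0))" by (simp add: linear_simps)
  then show ?case using has_parity.intros(1,2) by blast
next
  case (E x)
  have "cls (E x) = cls (Add (E x) (Car 0))" "cls (E x) = cls (Add (Car 0) (E x))"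
    by (simp_all add: linear_simps)
  then show ?case
    using has_parity.intros(2) [of v 0] has_parity.intros(2) [of v 1] has_parity.intros(3) [of v x]
    by (cases "par v x") auto
next
  case (F x)
  have "cls (F x) = cls (Add (F x) (Car 0))" "cls (F x) = cls (Add (Car 0) (F x))"
    by (simp_all add: linear_simps)
  then show ?case
    using has_parity.intros(2) [of v 0] has_parity.intros(2) [of v 1] has_parity.intros(4) [of v x]
    by (cases "par v x") auto
next
  case (Add s t)
  then obtain s0 s1 t0 t1 where "has_parity v 0 s0" "has_parity v 1 s1" "cls s = cls (Add s0 s1)"
    "has_parity v 0 t0" "has_parity v 1 t1" "cls t = cls (Add t0 t1)" by blast
  then show ?case
    by (intro exI [of _ "Add s0 t0"] exI [of _ "Add s1 t1"])
      (simp add: linear_simps has_parity.intros plus_assoc plus_left_comm)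
next
  case (Scl c s)
  then obtain s0 s1 where "has_parity v 0 s0" "has_parity v 1 s1" "cls s = cls (Add s0 s1)"
    by blast
  then show ?case
    by (intro exI [of _ "Scl c s0"] exI [of _ "Scl c s1"])
      (simp add: linear_simps has_parity.intros)
next
  case (Brk s t)
  then obtain s0 s1 t0 t1 where st: "has_parity v 0 s0" "has_parity v 1 s1" "cls s = cls (Add s0 s1)"
    "has_parity v 0 t0" "has_parity v 1 t1" "cls t = cls (Add t0 t1)" by blast
  have "has_parity v 0 (Brk s0 t0)" "has_parity v 0 (Brk s1 t1)"
    "has_parity v 1 (Brk s0 t1)" "has_parity v 1 (Brk s1 t0)"
    using has_parity.intros(7) [OF st(1,4)] has_parity.intros(7) [OF st(2,5)]
      has_parity.intros(7) [OF st(1,5)] has_parity.intros(7) [OF st(2,4)] by simp_all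
  then show ?case
    using cls_Brk_cong [OF st(3,6)]
    by (intro exI [of _ "Add (Brk s0 t0) (Brk s1 t1)"] exI [of _ "Add (Brk s0 t1) (Brk s1 t0)"])
      (simp add: linear_simps has_parity.intros plus_assoc plus_left_comm plus_comm)
qed

lemma triangular_decomposition: "triangular UNIV s"
proof (induction s)
  case (E x)
  then show ?case using tri_word [of True UNIV "[]" x] by (simp add: gen_def)
next
  case (F x)
  then show ?case using tri_word [of False UNIV "[]" x] by (simp add: gen_def)
next
  case (Brk s t)
  obtain s0 s1 where s: "has_parity v 0 s0" "has_parity v 1 s1" "cls s = cls (Add s0 s1)"
    using ex_homogeneous by blast
  have "triangular UNIV (Add (Brk s0 t) (Brk s1 t))"
    using s tri_homogeneous [OF _ Brk(2)] by (blast intro: tri_Add)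
  then show ?case
    by (rule tri_cong) (simp add: cls_Brk_cong [OF s(3) HOL.refl] linear_simps)
qed (auto intro: tri_Car tri_Add tri_Scl)

text \<open>Candidates for weights: a word may well vanish modulo the congruence.\<close>

definition weights :: "('h \<Rightarrow> complex) set" where
  "weights = insert (\<lambda>_. 0) {word_weight \<sigma> xs y | \<sigma> xs y. True}"

text \<open>If the generator is the only word of its weight, all other words and the Cartan part of
  a triangular expression fall into other weights, so one multiple of the generator splits
  off.\<close>

lemma span_decomposition:
  assumes distinct: "\<And>\<tau> xs y. word_weight \<tau> xs y = word_weight \<sigma> [] x \<Longrightarrow> word \<tau> xs y = gen \<sigma> x"
    and nonzero: "word_weight \<sigma> [] x \<noteq> (\<lambda>_. 0)"
  shows "\<exists>c t'. cls t = plus (scale c (cls (gen \<sigma> x))) (cls t') \<and>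
           weight_span (weights - {word_weight \<sigma> [] x}) t'"
  using triangular_decomposition [of t]
proof (induction rule: triangular.induct)
  case (tri_Car h)
  have "weight_span (weights - {word_weight \<sigma> [] x}) (Car h)"
    by (rule span_base [OF weight_Car]) (use nonzero in \<open>auto simp: weights_def\<close>)
  then show ?case by (intro exI [of _ 0] exI [of _ "Car h"]) (simp add: linear_simps)
next
  case (tri_word \<tau> xs y)
  show ?case
  proof (cases "word_weight \<tau> xs y = word_weight \<sigma> [] x")
    case True
    then show ?thesis
      by (intro exI [of _ 1] exI [of _ "Car 0"]) (simp add: linear_simps distinct span_zero)
  next
    case False
    then have "weight_span (weights - {word_weight \<sigma> [] x}) (word \<tau> xs y)"
      by (intro span_base [OF weight_word]) (auto simp: weights_def)
    then show ?thesis
      by (intro exI [of _ 0] exI [of _ "word \<tau> xs y"]) (simp add: linear_simps)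
  qed
next
  case (tri_Add s t)
  then obtain c s' d t' where *: "cls s = plus (scale c (cls (gen \<sigma> x))) (cls s')"
    "weight_span (weights - {word_weight \<sigma> [] x}) s'"
    "cls t = plus (scale d (cls (gen \<sigma> x))) (cls t')"
    "weight_span (weights - {word_weight \<sigma> [] x}) t'" by blast
  then show ?case
    by (intro exI [of _ "c + d"] exI [of _ "Add s' t'"])
      (simp add: linear_simps span_Add scale_add plus_assoc plus_left_comm)
next
  case (tri_Scl s c)
  then obtain d s' where *: "cls s = plus (scale d (cls (gen \<sigma> x))) (cls s')"
    "weight_span (weights - {word_weight \<sigma> [] x}) s'" by blast
  then show ?case
    by (intro exI [of _ "c * d"] exI [of _ "Scl c s'"]) (simp add: linear_simps span_Scl)
next
  case (tri_cong s t)
  then show ?case by simp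
qed

lemma span_weights: "weight_span weights t"
  using triangular_decomposition [of t]
proof (induction rule: triangular.induct)
  case (tri_Car h)
  show ?case by (rule span_base [OF weight_Car]) (simp add: weights_def)
next
  case (tri_word \<sigma> xs y)
  show ?case by (rule span_base [OF weight_word]) (auto simp: weights_def)
next
  case (tri_cong s t)
  then show ?case using span_cong by blast
qed (auto intro: span_Add span_Scl)

lemma weight_in_weights: "weight \<alpha> t \<Longrightarrow> cls t \<noteq> cls (Car 0) \<Longrightarrow> \<alpha> \<in> weights"
  using weight_not_in_span span_weights by blast

end

subsection \<open>Root data\<close>

definition nonneg_span :: "('h, 'x::finite) root_data \<Rightarrow> ('h \<Rightarrow> complex) \<Rightarrow> bool" where
  "nonneg_span u \<alpha> \<longleftrightarrow> (\<exists>n :: 'x \<Rightarrow> nat. \<alpha> = (\<lambda>h. \<Sum>x\<in>UNIV. of_nat (n x) * rt u x h))"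

lemma vector_space_smult: "is_root_datum v \<Longrightarrow> vector_space (smult v)"
  by (simp add: is_root_datum_def)

lemma linear_rt: "is_root_datum v \<Longrightarrow> Vector_Spaces.linear (smult v) (*) (rt v x)"
  by (simp add: is_root_datum_def)

lemma rt_independent:
  fixes v :: "('h::ab_group_add, 'x::finite) root_data"
  assumes "is_root_datum v" "\<And>h. (\<Sum>x\<in>UNIV. c x * rt v x h) = 0"
  shows "c x = 0"
  using assms by (auto simp: is_root_datum_def)

lemma rt_independent_eq:
  fixes v :: "('h::ab_group_add, 'x::finite) root_data"
  assumes "is_root_datum v"
    and "\<And>h. (\<Sum>x\<in>UNIV. c x * rt v x h) = (\<Sum>x\<in>UNIV. d x * rt v x h)"
  shows "c x = d x"
proof -
  have "(\<Sum>x\<in>UNIV. (c x - d x) * rt v x h) = 0" for h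
    using assms(2) [of h] by (simp add: left_diff_distrib sum_subtractf)
  from rt_independent [OF assms(1) this] show ?thesis by simp
qed

lemma rt_as_sum:
  fixes v :: "('h, 'x::finite) root_data"
  shows "rt v y h = (\<Sum>x\<in>UNIV. (if x = y then 1 else 0) * rt v x h)"
  by (subst sum.remove [of _ y]) simp_all

lemma cor_nonzero:
  fixes v :: "('h::ab_group_add, 'x::finite) root_data"
  assumes "is_root_datum v" shows "cor v x \<noteq> 0"
proof
  assume "cor v x = 0"
  interpret vector_space "smult v" by (rule vector_space_smult [OF assms])
  let ?c = "\<lambda>y. if y = x then 1 else 0 :: complex"
  have "\<forall>c. (\<Sum>y\<in>UNIV. smult v (c y) (cor v y)) = 0 \<longrightarrow> (\<forall>y. c y = 0)"
    using assms by (simp add: is_root_datum_def)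
  from spec [OF this, of ?c] have "\<forall>y. ?c y = 0"
  proof (rule mp)
    show "(\<Sum>y\<in>UNIV. smult v (?c y) (cor v y)) = 0"
      by (intro sum.neutral) (use \<open>cor v x = 0\<close> in auto)
  qed
  from spec [OF this, of x] show False by simp
qed

lemma sum_list_count:
  fixes f :: "'x::finite \<Rightarrow> 'a::comm_semiring_1"
  shows "(\<Sum>x\<leftarrow>xs. f x) = (\<Sum>x\<in>UNIV. of_nat (count_list xs x) * f x)"
proof (induction xs)
  case (Cons y ys)
  have "of_nat (count_list (y # ys) x) * f x
      = (if x = y then f x else 0) + of_nat (count_list ys x) * f x" for x
    by (simp add: algebra_simps)
  then have "(\<Sum>x\<in>UNIV. of_nat (count_list (y # ys) x) * f x)
      = (\<Sum>x\<in>UNIV. if x = y then f x else 0) + (\<Sum>x\<in>UNIV. of_nat (count_list ys x) * f x)"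
    by (simp only: sum.distrib)
  then show ?case using Cons by simp
qed simp

section \<open>Weights when the simple roots are linearly independent\<close>

context lie_congruence
begin

lemma cls_sym: "s \<approx> t \<Longrightarrow> cls t = cls s"
  unfolding cls_eq_iff by (rule sym)

lemma word_weight_count:
  "word_weight \<sigma> xs y h
     = (\<Sum>x\<in>UNIV. ((if \<sigma> then 1 else - 1) * of_nat (count_list (y # xs) x)) * rt v x h)"
  unfolding word_weight_def sum_list_count by (simp only: sum_distrib_left mult.assoc)

text \<open>By independence the signed letter counts agree. A letter that occurs has positive count,
  which forces equal signs and leaves x as the only letter; its count 1 then leaves no room for
  \<open>xs\<close>.\<close>

lemma word_weight_inj:
  assumes "is_root_datum v" "word_weight \<tau> xs y = word_weight \<sigma> [] x"
  shows "\<tau> = \<sigma> \<and> xs = [] \<and> y = x"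
proof -
  have eq: "(if \<tau> then 1 else - 1) * of_nat (count_list (y # xs) z)
      = (if \<sigma> then 1 else - 1) * (of_nat (count_list [x] z) :: complex)" for z
    by (rule rt_independent_eq [OF assms(1), where
          c = "\<lambda>z. (if \<tau> then 1 else - 1) * of_nat (count_list (y # xs) z)" and
          d = "\<lambda>z. (if \<sigma> then 1 else - 1) * of_nat (count_list [x] z)"])
      (simp only: word_weight_count [symmetric] assms(2))
  have "\<tau> = \<sigma> \<and> count_list (y # xs) z = count_list [x] z" if "z = y \<or> z \<in> set xs" for z
  proof -
    have "count_list (y # xs) z \<noteq> 0"
      using that by (metis count_list_0_iff list.set_intros)
    then obtain k where k: "count_list (y # xs) z = Suc k" by (cases "count_list (y # xs) z") auto
    have l: "(if \<tau> then 1 else - 1) * complex_of_nat (Suc k)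
        = (if \<sigma> then 1 else - 1) * of_nat (count_list [x] z)"
      using eq [of z] unfolding k .
    \<comment> \<open>Over the integers, order is available: opposite signs cannot balance a
      positive count.\<close>
    have "(if \<tau> then 1 else - 1) * int (Suc k) = (if \<sigma> then 1 else - 1) * int (count_list [x] z)"
    proof -
      have "complex_of_int ((if \<tau> then 1 else - 1) * int (Suc k))
          = of_int ((if \<sigma> then 1 else - 1) * int (count_list [x] z))"
        using l by (cases \<tau>; cases \<sigma>) simp_all
      then show ?thesis by (simp only: of_int_eq_iff)
    qed
    then show ?thesis unfolding k by (cases \<tau>; cases \<sigma>) (auto split: if_splits)
  qed
  note * = this
  have "y = x" using * [of y] by (auto split: if_splits)
  moreover have "xs = []"
  proof (cases xs)
    case (Cons z zs)
    then have "z = x" using * [of z] by (auto split: if_splits)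
    then show ?thesis using * [of x] Cons \<open>y = x\<close> by simp
  qed
  ultimately show ?thesis using * [of y] by simp
qed

lemma word_weight_nonzero:
  assumes "is_root_datum v" shows "word_weight \<sigma> [] x \<noteq> (\<lambda>_. 0)"
proof
  assume "word_weight \<sigma> [] x = (\<lambda>_. 0)"
  then have "(if \<sigma> then 1 else - 1) * of_nat (count_list [x] x) = (0::complex)"
    by (intro rt_independent [OF assms, where
          c = "\<lambda>z. (if \<sigma> then 1 else - 1) * of_nat (count_list [x] z)"])
      (simp only: word_weight_count [symmetric])
  then show False by (simp split: if_splits)
qed

text \<open>After subtracting its multiple of the generator, t still has the root as its weight, yet
  it is a sum of vectors of other weights; hence nothing remains.\<close>

lemma real_root_space:
  assumes "is_root_datum v" "weight (word_weight \<sigma> [] x) t"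
  shows "\<exists>c. cls t = scale c (cls (gen \<sigma> x))"
proof -
  let ?\<alpha> = "word_weight \<sigma> [] x"
  have "word \<tau> xs y = gen \<sigma> x" if "word_weight \<tau> xs y = ?\<alpha>" for \<tau> xs y
    using word_weight_inj [OF assms(1) that] by simp
  from span_decomposition [OF this word_weight_nonzero [OF assms(1)]]
  obtain c t' where t: "cls t = plus (scale c (cls (gen \<sigma> x))) (cls t')"
    and t': "weight_span (weights - {?\<alpha>}) t'" by blast
  have "cls (Add t (Scl (- c) (gen \<sigma> x))) = cls t'"
  proof -
    have "plus (scale c (cls (gen \<sigma> x))) (scale (- c) (cls (gen \<sigma> x))) = cls (Car 0)"
      by (simp add: scale_add [symmetric] scale_0)
    moreover have "cls (Add t (Scl (- c) (gen \<sigma> x)))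
        = plus (cls t') (plus (scale c (cls (gen \<sigma> x))) (scale (- c) (cls (gen \<sigma> x))))"
      by (simp only: cls_Add cls_Scl t plus_assoc plus_left_comm [of "cls t'"])
    ultimately show ?thesis by (simp add: plus_zero)
  qed
  moreover have "weight ?\<alpha> (gen \<sigma> x)" using weight_word [of \<sigma> "[]" x] by simp
  ultimately have "weight ?\<alpha> t'"
    using weight_Add [OF assms(2) weight_Scl] weight_cong by blast
  then have "cls t' = cls (Car 0)" using weight_not_in_span [OF t'] by blast
  then have "cls t = cls (Scl c (gen \<sigma> x))"
    by (simp only: t cls_Scl [symmetric] plus_zero)
  then show ?thesis by (auto simp: cls_Scl)
qed

lemma weights_nonneg:
  assumes "\<alpha> \<in> weights" shows "nonneg_span v \<alpha> \<or> nonneg_span v (\<lambda>h. - \<alpha> h)"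
proof -
  have True: "nonneg_span v (word_weight True xs y)" for xs y
    unfolding nonneg_span_def
    by (intro exI [of _ "count_list (y # xs)"] ext) (simp add: word_weight_count)
  have False: "nonneg_span v (\<lambda>h. - word_weight False xs y h)" for xs y
    unfolding nonneg_span_def
    by (intro exI [of _ "count_list (y # xs)"] ext) (simp add: word_weight_count flip: sum_negf)
  consider "\<alpha> = (\<lambda>_. 0)" | \<sigma> xs y where "\<alpha> = word_weight \<sigma> xs y"
    using assms unfolding weights_def by blast
  then show ?thesis
  proof cases
    case 1
    then show ?thesis
      unfolding nonneg_span_def by (intro disjI1 exI [of _ "\<lambda>_. 0"]) simp
  next
    case 2
    then show ?thesis using True False by (cases \<sigma>) auto
  qed
qed

end

subsection \<open>Quotients of the half-baked Lie superalgebra\<close>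

lemma hb_congruence: "lie_congruence v (hb_eq v)"
  by (rule lie_congruence.intro; (assumption | erule hb_sym | erule (1) hb_trans
        | erule (1) cong_add | erule cong_scl | erule (1) cong_brk))

locale hb_quotient =
  fixes v :: "('h::ab_group_add, 'x::finite) root_data" and I :: "('h, 'x) lie_expr set set"
  assumes ideal: "graded_ideal (hb v) I"
begin

definition qeq :: "('h, 'x) lie_expr \<Rightarrow> ('h, 'x) lie_expr \<Rightarrow> bool" where
  "qeq s t \<longleftrightarrow> hb_cls v (Add s (Scl (- 1) t)) \<in> I"

text \<open>The element of the quotient record itself: a set of classes, in contrast to
  \<open>q.cls\<close>, which is a set of expressions. Both identify exactly the pairs related by
  \<open>qeq\<close>, and the weight calculus is available for the latter.\<close>

definition qcls :: "('h, 'x) lie_expr \<Rightarrow> ('h, 'x) lie_expr set set" where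
  "qcls s = coset (hb v) I (hb_cls v s)"

end

sublocale hb_quotient \<subseteq> hb: lie_congruence v "hb_eq v"
  by (rule hb_congruence)

context hb_quotient
begin

lemma hb_cls_eq: "hb_cls v = hb.cls"
  by (simp add: fun_eq_iff hb_cls_def hb.cls_def)

lemma hb_add: "add (hb v) (hb.cls s) (hb.cls t) = hb.cls (Add s t)"
  by (subst hb.cls_Add) (simp add: hb_def hb_cls_eq hb.plus_def)

lemma hb_scl: "scl (hb v) c (hb.cls s) = hb.cls (Scl c s)"
  by (subst hb.cls_Scl) (simp add: hb_def hb_cls_eq hb.scale_def)

lemma hb_brk: "brk (hb v) (hb.cls s) (hb.cls t) = hb.cls (Brk s t)"
proof -
  have "brk (hb v) (hb.cls s) (hb.cls t) = (\<Union>s'\<in>hb.cls s. \<Union>t'\<in>hb.cls t. hb.cls (Brk s' t'))"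
    by (simp add: hb_def hb_cls_eq)
  also have "\<dots> = (\<Union>s'\<in>hb.cls s. hb.cls (Brk s' t))"
    by (intro SUP_cong HOL.refl hb.UN_cls) (rule hb.cls_Brk_cong [OF HOL.refl hb.cls_sym])
  also have "\<dots> = hb.cls (Brk s t)"
    by (intro hb.UN_cls) (rule hb.cls_Brk_cong [OF hb.cls_sym HOL.refl])
  finally show ?thesis .
qed

lemma hb_zer: "zer (hb v) = hb.cls (Car 0)"
  by (simp add: hb_def hb_cls_eq)

lemma hb_carr: "carr (hb v) = range hb.cls"
  by (simp add: hb_def hb_cls_eq)

lemma ideal_carr: "A \<in> I \<Longrightarrow> \<exists>s. A = hb.cls s"
  using ideal hb_carr by (auto simp: graded_ideal_def)

lemma ideal_zero: "hb.cls (Car 0) \<in> I"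
  using ideal hb_zer by (simp add: graded_ideal_def)

lemma ideal_Add: "hb.cls s \<in> I \<Longrightarrow> hb.cls t \<in> I \<Longrightarrow> hb.cls (Add s t) \<in> I"
  using ideal hb_add [of s t] unfolding graded_ideal_def by metis

lemma ideal_Scl: "hb.cls s \<in> I \<Longrightarrow> hb.cls (Scl c s) \<in> I"
  using ideal hb_scl [of c s] unfolding graded_ideal_def by metis

lemma ideal_Brk: "hb.cls s \<in> I \<Longrightarrow> hb.cls (Brk t s) \<in> I \<and> hb.cls (Brk s t) \<in> I"
  using ideal hb_brk [of s t] hb_brk [of t s] hb_carr unfolding graded_ideal_def by (metis rangeI)

lemma qeq_iff: "qeq s t \<longleftrightarrow> hb.cls (Add s (Scl (- 1) t)) \<in> I"
  by (simp add: qeq_def hb_cls_eq)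

lemma qeq_hb: "hb_eq v s t \<Longrightarrow> qeq s t"
proof -
  assume "hb_eq v s t"
  then have "hb.cls (Add s (Scl (- 1) t)) = hb.cls (Car 0)"
    by (simp add: hb.cls_hb hb.cls_Add hb.cls_Scl hb.plus_inv)
  then show ?thesis by (simp add: qeq_iff ideal_zero)
qed

lemma qeq_sym: "qeq s t \<Longrightarrow> qeq t s"
proof -
  assume "qeq s t"
  then have "hb.cls (Scl (- 1) (Add s (Scl (- 1) t))) \<in> I" by (simp add: qeq_iff ideal_Scl)
  then show ?thesis
    by (simp add: qeq_iff hb.linear_simps hb.plus_comm)
qed

lemma qeq_trans: assumes "qeq s t" "qeq t u" shows "qeq s u"
proof -
  have "hb.cls (Add (Add s (Scl (- 1) t)) (Add t (Scl (- 1) u))) \<in> I"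
    using assms by (simp add: qeq_iff ideal_Add)
  moreover have "hb.cls (Add (Add s (Scl (- 1) t)) (Add t (Scl (- 1) u)))
      = hb.plus (hb.plus (hb.cls s) (hb.scale (- 1) (hb.cls u)))
          (hb.plus (hb.cls t) (hb.scale (- 1) (hb.cls t)))"
    by (simp only: hb.cls_Add hb.cls_Scl hb.plus_assoc hb.plus_comm hb.plus_left_comm)
  moreover have "\<dots> = hb.cls (Add s (Scl (- 1) u))"
    by (simp only: hb.plus_inv) (metis hb.cls_Add hb.cls_Scl hb.plus_zero)
  ultimately show ?thesis by (simp add: qeq_iff)
qed

lemma qeq_Add: assumes "qeq s s'" "qeq t t'" shows "qeq (Add s t) (Add s' t')"
proof -
  have "hb.cls (Add (Add s (Scl (- 1) s')) (Add t (Scl (- 1) t'))) \<in> I"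
    using assms by (simp add: qeq_iff ideal_Add)
  then show ?thesis
    by (simp add: qeq_iff hb.linear_simps hb.plus_assoc hb.plus_left_comm)
qed

lemma qeq_Scl: assumes "qeq s s'" shows "qeq (Scl c s) (Scl c s')"
proof -
  have "hb.cls (Scl c (Add s (Scl (- 1) s'))) \<in> I"
    using assms by (simp add: qeq_iff ideal_Scl)
  then show ?thesis
    by (simp add: qeq_iff hb.linear_simps)
qed

lemma qeq_Brk: assumes "qeq s s'" "qeq t t'" shows "qeq (Brk s t) (Brk s' t')"
proof (rule qeq_trans)
  have "hb.cls (Brk (Add s (Scl (- 1) s')) t) \<in> I"
    using assms by (simp add: qeq_iff ideal_Brk)
  then show "qeq (Brk s t) (Brk s' t)"
    by (simp add: qeq_iff hb.linear_simps)
  have "hb.cls (Brk s' (Add t (Scl (- 1) t'))) \<in> I"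
    using assms by (simp add: qeq_iff ideal_Brk)
  then show "qeq (Brk s' t) (Brk s' t')"
    by (simp add: qeq_iff hb.linear_simps)
qed

end

sublocale hb_quotient \<subseteq> q: lie_congruence v qeq
  by unfold_locales (fact qeq_hb qeq_sym qeq_trans qeq_Add qeq_Scl qeq_Brk)+

context hb_quotient
begin

text \<open>An element s + b of the coset differs from s by b in the ideal; conversely t is s plus
  the difference t - s.\<close>

lemma qcls_image: "qcls s = hb.cls ` {t. qeq s t}"
proof
  show "qcls s \<subseteq> hb.cls ` {t. qeq s t}"
  proof
    fix A assume "A \<in> qcls s"
    then obtain B where "B \<in> I" "A = add (hb v) (hb.cls s) B"
      by (auto simp: qcls_def coset_def hb_cls_eq)
    then obtain b where b: "hb.cls b \<in> I" "A = hb.cls (Add s b)"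
      using ideal_carr hb_add by metis
    have "hb.cls (Add (Add s b) (Scl (- 1) s)) = hb.cls b"
    proof -
      have "hb.cls (Add (Add s b) (Scl (- 1) s))
          = hb.plus (hb.cls b) (hb.plus (hb.cls s) (hb.scale (- 1) (hb.cls s)))"
        by (simp only: hb.cls_Add hb.cls_Scl hb.plus_assoc hb.plus_left_comm [of "hb.cls b"])
      then show ?thesis by (simp add: hb.plus_inv hb.plus_zero)
    qed
    then have "qeq (Add s b) s" using b(1) by (simp add: qeq_iff)
    then show "A \<in> hb.cls ` {t. qeq s t}" using b(2) qeq_sym by blast
  qed
  show "hb.cls ` {t. qeq s t} \<subseteq> qcls s"
  proof clarify
    fix t assume "qeq s t"
    then have "hb.cls (Add t (Scl (- 1) s)) \<in> I" using qeq_sym by (simp add: qeq_iff)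
    moreover have "hb.cls t = add (hb v) (hb.cls s) (hb.cls (Add t (Scl (- 1) s)))"
    proof -
      have "add (hb v) (hb.cls s) (hb.cls (Add t (Scl (- 1) s)))
          = hb.plus (hb.cls t) (hb.plus (hb.cls s) (hb.scale (- 1) (hb.cls s)))"
        by (subst hb_add)
          (simp only: hb.cls_Add hb.cls_Scl hb.plus_assoc hb.plus_left_comm [of "hb.cls s"])
      then show ?thesis by (simp add: hb.plus_inv hb.plus_zero)
    qed
    ultimately show "hb.cls t \<in> qcls s"
      unfolding qcls_def coset_def hb_cls_eq by blast
  qed
qed

lemma qcls_eq_iff: "qcls s = qcls t \<longleftrightarrow> qeq s t"
proof
  assume "qcls s = qcls t"
  moreover have "hb.cls s \<in> qcls s" using q.refl by (auto simp: qcls_image)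
  ultimately have "hb.cls s \<in> qcls t" by simp
  then obtain t' where "hb.cls s = hb.cls t'" "qeq t t'" by (auto simp: qcls_image)
  then show "qeq s t" by (metis hb.cls_eq_iff qeq_hb qeq_sym qeq_trans)
next
  assume "qeq s t"
  then have "{u. qeq s u} = {u. qeq t u}" using qeq_sym qeq_trans by blast
  then show "qcls s = qcls t" by (simp add: qcls_image)
qed

lemma quotient_carr: "carr (quotient_lsa (hb v) I) = range qcls"
  by (auto simp: quotient_lsa_def hb_carr qcls_def hb_cls_eq)

lemma quotient_scl: "scl (quotient_lsa (hb v) I) c (qcls s) = qcls (Scl c s)"
proof -
  have "scl (quotient_lsa (hb v) I) c (qcls s) = (\<Union>s'\<in>{s'. qeq s s'}. qcls (Scl c s'))"
    unfolding quotient_lsa_def qcls_image [of s] by (simp add: hb_scl qcls_def hb_cls_eq)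
  also have "\<dots> = (\<Union>s'\<in>{s'. qeq s s'}. qcls (Scl c s))"
    by (intro SUP_cong HOL.refl) (simp add: qcls_eq_iff qeq_sym [OF qeq_Scl])
  also have "\<dots> = qcls (Scl c s)" using q.refl by blast
  finally show ?thesis .
qed

lemma quotient_brk: "brk (quotient_lsa (hb v) I) (qcls s) (qcls t) = qcls (Brk s t)"
proof -
  have "brk (quotient_lsa (hb v) I) (qcls s) (qcls t)
      = (\<Union>s'\<in>{s'. qeq s s'}. \<Union>t'\<in>{t'. qeq t t'}. qcls (Brk s' t'))"
    unfolding quotient_lsa_def qcls_image [of s] qcls_image [of t]
    by (simp add: hb_brk qcls_def hb_cls_eq)
  also have "\<dots> = (\<Union>s'\<in>{s'. qeq s s'}. \<Union>t'\<in>{t'. qeq t t'}. qcls (Brk s t))"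
    by (intro SUP_cong HOL.refl) (simp add: qcls_eq_iff qeq_sym [OF qeq_Brk])
  also have "\<dots> = qcls (Brk s t)" using q.refl by blast
  finally show ?thesis .
qed

end

section \<open>Comparison of two quotients by an isomorphism fixing the Cartan space\<close>

locale hb_iso = A: hb_quotient v I + B: hb_quotient v' I'
  for v v' :: "('h::ab_group_add, 'x::finite) root_data" and I I' +
  fixes \<Psi>
  assumes datum: "is_root_datum v" and datum': "is_root_datum v'"
    and embed: "\<And>h. hb_cls v (Car h) \<in> I \<Longrightarrow> h = 0"
    and embed': "\<And>h. hb_cls v' (Car h) \<in> I' \<Longrightarrow> h = 0"
    and iso: "lsa_iso (quotient_lsa (hb v) I) (quotient_lsa (hb v') I') \<Psi>"
    and iso_Car: "\<And>h. \<Psi> (coset (hb v) I (hb_cls v (Car h))) = coset (hb v') I' (hb_cls v' (Car h))"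
begin

lemma iso_ex: "\<exists>t. \<Psi> (A.qcls s) = B.qcls t"
proof -
  have "\<Psi> ` range A.qcls = range B.qcls"
    using iso by (simp add: lsa_iso_def bij_betw_def A.quotient_carr B.quotient_carr)
  then show ?thesis by blast
qed

lemma iso_inj: "\<Psi> (A.qcls s) = \<Psi> (A.qcls t) \<Longrightarrow> A.qcls s = A.qcls t"
proof -
  have "inj_on \<Psi> (range A.qcls)"
    using iso by (simp add: lsa_iso_def bij_betw_def A.quotient_carr)
  then show "\<Psi> (A.qcls s) = \<Psi> (A.qcls t) \<Longrightarrow> A.qcls s = A.qcls t"
    by (auto dest: inj_onD)
qed

lemma iso_Scl: "\<Psi> (A.qcls s) = B.qcls t \<Longrightarrow> \<Psi> (A.qcls (Scl c s)) = B.qcls (Scl c t)"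
  using iso by (simp add: lsa_iso_def A.quotient_carr flip: A.quotient_scl B.quotient_scl)

lemma iso_Brk:
  "\<Psi> (A.qcls s) = B.qcls t \<Longrightarrow> \<Psi> (A.qcls s') = B.qcls t' \<Longrightarrow>
     \<Psi> (A.qcls (Brk s s')) = B.qcls (Brk t t')"
  using iso by (simp add: lsa_iso_def A.quotient_carr flip: A.quotient_brk B.quotient_brk)

lemma iso_Car': "\<Psi> (A.qcls (Car h)) = B.qcls (Car h)"
  using iso_Car by (simp add: A.qcls_def B.qcls_def)

text \<open>As the isomorphism fixes \<open>Car h\<close>, it carries eigenvectors of h to
  eigenvectors with the same eigenvalue.\<close>

lemma iso_weight:
  assumes "A.q.weight \<alpha> s" "\<Psi> (A.qcls s) = B.qcls t" shows "B.q.weight \<alpha> t"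
  unfolding B.q.weight_def
proof
  fix h
  have "A.qcls (Brk (Car h) s) = A.qcls (Scl (\<alpha> h) s)"
    using assms(1) by (simp add: A.qcls_eq_iff A.q.weight_def flip: A.q.cls_eq_iff A.q.cls_Scl)
  then have "B.qcls (Brk (Car h) t) = B.qcls (Scl (\<alpha> h) t)"
    using iso_Brk [OF iso_Car' assms(2)] iso_Scl [OF assms(2)] by metis
  then show "B.q.cls (Brk (Car h) t) = B.q.scale (\<alpha> h) (B.q.cls t)"
    by (simp add: B.qcls_eq_iff flip: B.q.cls_eq_iff B.q.cls_Scl)
qed

lemma Car_inj:
  assumes "B.qeq (Car h) (Car k)" shows "h = k"
proof -
  interpret vector_space "smult v'" by (rule vector_space_smult [OF datum'])
  have "B.hb.cls (Add (Car h) (Scl (- 1) (Car k))) = B.hb.cls (Car (h - k))"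
    using B.hb.cls_hb [OF car_add, of h "- k"] B.hb.cls_hb [OF car_scl, of "- 1" k]
    by (simp add: B.hb.cls_Add)
  then have "hb_cls v' (Car (h - k)) \<in> I'"
    using assms by (simp add: B.qeq_iff B.hb_cls_eq)
  then show ?thesis using embed' by fastforce
qed

text \<open>If e_x vanished, so would a(x) = [e_x, f_x]; but a(x) is nonzero and the ideal meets the
  Cartan space trivially.\<close>

lemma E_nonzero: "A.qcls (E x) \<noteq> A.qcls (Car 0)"
proof
  assume "A.qcls (E x) = A.qcls (Car 0)"
  then have "A.q.cls (Brk (E x) (F x)) = A.q.cls (Brk (Car 0) (F x))"
    by (intro A.q.cls_Brk_cong) (simp_all add: A.qcls_eq_iff A.q.cls_eq_iff)
  then have "A.q.cls (Car (cor v x)) = A.q.cls (Car 0)"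
    using A.q.cls_hb [OF rel_ef_same] by (simp add: A.q.cls_Brk_zero_left)
  then have "A.hb.cls (Add (Car (cor v x)) (Scl (- 1) (Car 0))) \<in> I"
    by (simp add: A.q.cls_eq_iff A.qeq_iff)
  then have "hb_cls v (Car (cor v x)) \<in> I"
    by (simp add: A.hb.linear_simps A.hb_cls_eq)
  then show False using embed cor_nonzero [OF datum] by blast
qed

text \<open>The image of e_x is a nonzero vector of weight b_v(x) in the other quotient, so this
  weight is one of the candidates there, and those have coefficients of one sign.\<close>

lemma root_sign: "nonneg_span v' (rt v x) \<or> nonneg_span v' (\<lambda>h. - rt v x h)"
proof -
  obtain t where t: "\<Psi> (A.qcls (E x)) = B.qcls t" using iso_ex by blast
  have "A.q.weight (rt v x) (E x)"
    using A.q.weight_gen [of True x] by (simp add: A.q.gen_def)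
  then have "B.q.weight (rt v x) t" using t by (rule iso_weight)
  moreover have "B.q.cls t \<noteq> B.q.cls (Car 0)"
    using E_nonzero [of x] iso_inj [of "E x" "Car 0"] t
    by (auto simp: iso_Car' B.q.cls_eq_iff B.qcls_eq_iff)
  ultimately show ?thesis by (intro B.q.weights_nonneg B.q.weight_in_weights)
qed

text \<open>The generators at x go to multiples, by c and d, of the generators at x', as the root
  spaces there are spanned by these. Bracketing the two images gives the factor
  \<open>c * d\<close>.\<close>

lemma coroot_unique_up_to_scalar:
  assumes "rt v x = rt v' x'" shows "\<exists>c. cor v x = smult v' c (cor v' x')"
proof -
  have *: "\<exists>t c. \<Psi> (A.qcls (A.q.gen \<sigma> x)) = B.qcls t \<and> B.q.cls t = B.q.cls (Scl c (B.q.gen \<sigma> x'))"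
    for \<sigma>
  proof -
    obtain t where t: "\<Psi> (A.qcls (A.q.gen \<sigma> x)) = B.qcls t" using iso_ex by blast
    have "A.q.word_weight \<sigma> [] x = B.q.word_weight \<sigma> [] x'"
      using assms by (simp add: fun_eq_iff A.q.word_weight_def B.q.word_weight_def)
    then have "B.q.weight (B.q.word_weight \<sigma> [] x') t"
      using iso_weight [OF _ t] A.q.weight_word [of \<sigma> "[]" x] by simp
    then show ?thesis using t B.q.real_root_space [OF datum'] by (metis B.q.cls_Scl)
  qed
  from * [of True] obtain s c
    where s: "\<Psi> (A.qcls (E x)) = B.qcls s" "B.q.cls s = B.q.cls (Scl c (E x'))"
    by (auto simp: A.q.gen_def B.q.gen_def)
  from * [of False] obtain t d
    where t: "\<Psi> (A.qcls (F x)) = B.qcls t" "B.q.cls t = B.q.cls (Scl d (F x'))"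
    by (auto simp: A.q.gen_def B.q.gen_def)
  have "A.qcls (Brk (E x) (F x)) = A.qcls (Car (cor v x))"
    by (simp add: A.qcls_eq_iff A.qeq_hb rel_ef_same)
  then have "B.qcls (Brk s t) = B.qcls (Car (cor v x))"
    using iso_Brk [OF s(1) t(1)] iso_Car' by metis
  then have "B.q.cls (Car (cor v x)) = B.q.cls (Brk (Scl c (E x')) (Scl d (F x')))"
    using B.q.cls_Brk_cong [OF s(2) t(2)] by (metis B.qcls_eq_iff B.q.cls_eq_iff)
  also have "\<dots> = B.q.scale (c * d) (B.q.cls (Car (cor v' x')))"
    using B.q.cls_hb [OF rel_ef_same] by (simp add: B.q.linear_simps mult.commute)
  also have "\<dots> = B.q.cls (Car (smult v' (c * d) (cor v' x')))"
    by (metis B.q.cls_Scl B.q.cls_hb car_scl)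
  finally have "cor v x = smult v' (c * d) (cor v' x')"
    by (intro Car_inj) (simp add: B.q.cls_eq_iff)
  then show ?thesis ..
qed

end

subsection \<open>Reflexions\<close>

lemma root_datum_eqI:
  fixes u u' :: "('h, 'x) root_data"
  shows "smult u = smult u' \<Longrightarrow> cor u = cor u' \<Longrightarrow> rt u = rt u' \<Longrightarrow> par u = par u' \<Longrightarrow> u = u'"
  by (cases u; cases u') simp

lemma rt_linear:
  assumes "is_root_datum u"
  shows "rt u y (a + b) = rt u y a + rt u y b" "rt u y (a - b) = rt u y a - rt u y b"
    "rt u y (- a) = - rt u y a" "rt u y (smult u c a) = c * rt u y a"
proof -
  interpret Vector_Spaces.linear "smult u" "(*)" "rt u y" by (rule linear_rt [OF assms])
  show "rt u y (a + b) = rt u y a + rt u y b" "rt u y (a - b) = rt u y a - rt u y b"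
    "rt u y (- a) = - rt u y a" "rt u y (smult u c a) = c * rt u y a"
    by (simp_all add: add diff neg scale)
qed

lemma sum_delta_shift:
  fixes f :: "'x::finite \<Rightarrow> complex"
  shows "(\<Sum>y\<in>UNIV. (k y + (if y = x then K else 0)) * f y) = (\<Sum>y\<in>UNIV. k y * f y) + K * f x"
proof -
  have "(\<Sum>y\<in>UNIV. (if y = x then K else 0) * f y) = (\<Sum>y\<in>UNIV. if y = x then K * f y else 0)"
    by (rule sum.cong) auto
  then show ?thesis by (simp add: distrib_right sum.distrib)
qed

text \<open>Away from x nothing is shifted, so those coefficients vanish; the sum is then
  \<open>- 2 * k x\<close>, and the equation at x reads \<open>- k x = 0\<close>.\<close>

lemma shift_zero:
  fixes k e :: "'x::finite \<Rightarrow> complex"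
  assumes "\<And>y. k y + (if y = x then \<Sum>z\<in>UNIV. k z * e z else 0) = 0" and "e x = - 2"
  shows "k y = 0"
proof -
  have *: "k y = 0" if "y \<noteq> x" for y using assms(1) [of y] that by simp
  have "(\<Sum>z\<in>UNIV. k z * e z) = (\<Sum>z\<in>UNIV. if z = x then k x * e x else 0)"
    by (rule sum.cong) (use * in auto)
  then have "k x = 0" using assms(1) [of x] assms(2) by simp
  with * show ?thesis by (cases "y = x") auto
qed

text \<open>The value -2 at x says that a(x) and b(x) change sign while the other vectors move by
  multiples of them, an invertible change of family. Both kinds of reflexion have this
  shape.\<close>

lemma is_root_datum_shift:
  fixes u u' :: "('h::ab_group_add, 'x::finite) root_data"
  assumes u: "is_root_datum u" and smult: "smult u' = smult u"
    and cor: "\<And>y. cor u' y = cor u y + smult u (c y) (cor u x)" and c: "c x = - 2"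
    and rt: "\<And>y h. rt u' y h = rt u y h + d y * rt u x h" and d: "d x = - 2"
  shows "is_root_datum u'"
proof -
  interpret vector_space "smult u" by (rule vector_space_smult [OF u])
  have "Vector_Spaces.linear (smult u) (*) (rt u' y)" for y
  proof -
    interpret y: Vector_Spaces.linear "smult u" "(*)" "rt u y" by (rule linear_rt [OF u])
    interpret x: Vector_Spaces.linear "smult u" "(*)" "rt u x" by (rule linear_rt [OF u])
    show ?thesis
      by unfold_locales (simp_all add: rt y.add x.add y.scale x.scale distrib_left mult.left_commute)
  qed
  moreover have "k y = 0" if k: "(\<Sum>y\<in>UNIV. smult u (k y) (cor u' y)) = 0" for k y
  proof -
    let ?K = "\<Sum>z\<in>UNIV. k z * c z"
    let ?k = "\<lambda>y. k y + (if y = x then ?K else 0)"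
    have "(\<Sum>y\<in>UNIV. smult u (if y = x then ?K else 0) (cor u y))
        = (\<Sum>y\<in>UNIV. if y = x then smult u ?K (cor u x) else 0)"
      by (rule sum.cong) auto
    then have "(\<Sum>y\<in>UNIV. smult u (?k y) (cor u y))
        = (\<Sum>y\<in>UNIV. smult u (k y) (cor u y)) + smult u ?K (cor u x)"
      by (simp add: scale_left_distrib sum.distrib)
    also have "\<dots> = (\<Sum>y\<in>UNIV. smult u (k y) (cor u' y))"
      by (simp add: cor scale_right_distrib sum.distrib scale_sum_left)
    finally have zero: "(\<Sum>y\<in>UNIV. smult u (?k y) (cor u y)) = 0" by (simp only: k)
    have "\<forall>k. (\<Sum>y\<in>UNIV. smult u (k y) (cor u y)) = 0 \<longrightarrow> (\<forall>y. k y = 0)"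
      using u by (simp add: is_root_datum_def)
    from spec [OF this, of ?k] have "\<forall>y. ?k y = 0" by (rule mp) (rule zero)
    then show ?thesis by (intro shift_zero [of k x c, OF _ c]) blast
  qed
  moreover have "k y = 0" if k: "\<And>h. (\<Sum>y\<in>UNIV. k y * rt u' y h) = 0" for k y
  proof -
    let ?K = "\<Sum>z\<in>UNIV. k z * d z"
    have "(\<Sum>y\<in>UNIV. (k y + (if y = x then ?K else 0)) * rt u y h) = 0" for h
      unfolding sum_delta_shift
      using k [of h] by (simp add: rt distrib_left sum.distrib sum_distrib_right mult.assoc)
    from rt_independent [OF u this] show ?thesis by (intro shift_zero [of k x d, OF _ d])
  qed
  ultimately show ?thesis
    using u unfolding is_root_datum_def smult by blast
qed

lemma smult_reflexion [simp]: "smult (reflexion u x) = smult u"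
  by (simp add: reflexion_def anisotropic_reflexion_def isotropic_reflexion_def)

lemma reflexion_shift:
  fixes u :: "('h::ab_group_add, 'x::finite) root_data"
  assumes "is_root_datum u"
  obtains c d where "c x = - 2" "d x = - 2"
    "\<And>y. cor (reflexion u x) y = cor u y + smult u (c y) (cor u x)"
    "\<And>y h. rt (reflexion u x) y h = rt u y h + d y * rt u x h"
proof (cases "cartan u x x = 0")
  case False
  interpret vector_space "smult u" by (rule vector_space_smult [OF assms])
  show ?thesis
    by (rule that [of "\<lambda>y. - (2 * cartan u y x / cartan u x x)" "\<lambda>y. - (2 * cartan u x y / cartan u x x)"])
      (use False in \<open>simp_all add: reflexion_def anisotropic_reflexion_def\<close>)
next
  case True
  interpret vector_space "smult u" by (rule vector_space_smult [OF assms])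
  have "- h = h + smult u (- 2) h" for h
    using scale_left_distrib [of 1 "- 2" h] by simp
  then show ?thesis
    by (intro that [of "\<lambda>y. if y = x then - 2 else if cartan u x y = 0 then 0 else cartan u y x / cartan u x y"
        "\<lambda>y. if y = x then - 2 else if cartan u x y = 0 then 0 else 1"])
      (use True in \<open>simp_all add: reflexion_def isotropic_reflexion_def\<close>)
qed

lemma is_root_datum_reflexion:
  fixes u :: "('h::ab_group_add, 'x::finite) root_data"
  assumes "is_root_datum u" shows "is_root_datum (reflexion u x)"
proof -
  obtain c d where "c x = - 2" "d x = - 2"
    "\<And>y. cor (reflexion u x) y = cor u y + smult u (c y) (cor u x)"
    "\<And>y h. rt (reflexion u x) y h = rt u y h + d y * rt u x h"
    using reflexion_shift [OF assms] by metis
  then show ?thesis by (intro is_root_datum_shift [OF assms smult_reflexion])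
qed

lemma cartan_reflexion_same:
  fixes u :: "('h::ab_group_add, 'x::finite) root_data"
  assumes "is_root_datum u"
  shows "cartan (reflexion u x) x x = cartan u x x"
proof -
  obtain c d where *: "c x = - 2" "d x = - 2"
    "\<And>y. cor (reflexion u x) y = cor u y + smult u (c y) (cor u x)"
    "\<And>y h. rt (reflexion u x) y h = rt u y h + d y * rt u x h"
    using reflexion_shift [OF assms] by metis
  show ?thesis by (simp add: cartan_def * rt_linear [OF assms])
qed

lemma cartan_anisotropic_reflexion:
  assumes "is_root_datum u" "cartan u x x \<noteq> 0"
  shows "cartan (anisotropic_reflexion u x) x y = cartan u x y"
    "cartan (anisotropic_reflexion u x) y x = cartan u y x"
  using assms(2)
  by (simp_all add: cartan_def anisotropic_reflexion_def rt_linear [OF assms(1)] field_simps)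

lemma cartan_isotropic_reflexion:
  assumes "is_root_datum u" "cartan u x x = 0"
  shows "cartan (isotropic_reflexion u x) x y = - cartan u x y"
    "cartan (isotropic_reflexion u x) y x = - cartan u y x"
  using assms(2)
  by (simp_all add: cartan_def isotropic_reflexion_def rt_linear [OF assms(1)])

text \<open>Row and column x of the Cartan matrix stay fixed in the anisotropic case and change sign
  together in the isotropic one. So the second reflexion has the same coefficients, applied to -a(x)
  and -b(x), and undoes the first.\<close>

lemma reflexion_reflexion:
  fixes u :: "('h::ab_group_add, 'x::finite) root_data"
  assumes "is_root_datum u"
  shows "reflexion (reflexion u x) x = u"
proof -
  interpret vector_space "smult u" by (rule vector_space_smult [OF assms])
  show ?thesis
  proof (cases "cartan u x x = 0")
    case False
    let ?u = "anisotropic_reflexion u x"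
    have two: "h - smult u 2 h = - h" for h
      using scale_left_distrib [of 1 1 h] by simp
    have "anisotropic_reflexion ?u x = u"
    proof (rule root_datum_eqI)
      show "smult (anisotropic_reflexion ?u x) = smult u" "par (anisotropic_reflexion ?u x) = par u"
        by (simp_all add: anisotropic_reflexion_def)
      show "cor (anisotropic_reflexion ?u x) = cor u"
      proof
        fix y
        have "cor (anisotropic_reflexion ?u x) y
            = cor ?u y - smult u (2 * cartan u y x / cartan u x x) (cor ?u x)"
          using cartan_anisotropic_reflexion [OF assms False]
          by (subst anisotropic_reflexion_def) (simp, simp add: anisotropic_reflexion_def)
        then show "cor (anisotropic_reflexion ?u x) y = cor u y"
          using False by (simp add: anisotropic_reflexion_def two)
      qed
      show "rt (anisotropic_reflexion ?u x) = rt u"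
      proof (intro ext)
        fix y h
        have "rt (anisotropic_reflexion ?u x) y h
            = rt ?u y h - 2 * cartan u x y / cartan u x x * rt ?u x h"
          using cartan_anisotropic_reflexion [OF assms False]
          by (subst anisotropic_reflexion_def) (simp, simp add: anisotropic_reflexion_def)
        then show "rt (anisotropic_reflexion ?u x) y h = rt u y h"
          using False by (simp add: anisotropic_reflexion_def)
      qed
    qed
    then show ?thesis
      using False cartan_anisotropic_reflexion [OF assms False] by (simp add: reflexion_def)
  next
    case True
    let ?u = "isotropic_reflexion u x"
    note cartan = cartan_isotropic_reflexion [OF assms True]
    have bit: "1 + (1 + b) = b" for b :: bit by (cases b) simp_all
    have "isotropic_reflexion ?u x = u"
    proof (rule root_datum_eqI)
      show "smult (isotropic_reflexion ?u x) = smult u"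
        by (simp add: isotropic_reflexion_def)
      show "par (isotropic_reflexion ?u x) = par u"
      proof
        fix y
        have "par (isotropic_reflexion ?u x) y = (if y = x then par ?u x
            else if cartan u x y = 0 then par ?u y else 1 + par ?u y)"
          by (subst isotropic_reflexion_def) (simp add: cartan)
        then show "par (isotropic_reflexion ?u x) y = par u y"
          by (simp add: isotropic_reflexion_def bit)
      qed
      show "cor (isotropic_reflexion ?u x) = cor u"
      proof
        fix y
        have "cor (isotropic_reflexion ?u x) y = (if y = x then - cor ?u x
            else if cartan u x y = 0 then cor ?u y
            else cor ?u y + smult u (cartan u y x / cartan u x y) (cor ?u x))"
          by (subst isotropic_reflexion_def) (simp add: cartan, simp add: isotropic_reflexion_def)
        then show "cor (isotropic_reflexion ?u x) y = cor u y"
          by (simp add: isotropic_reflexion_def)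
      qed
      show "rt (isotropic_reflexion ?u x) = rt u"
      proof
        fix y
        have "rt (isotropic_reflexion ?u x) y = (if y = x then (\<lambda>h. - rt ?u x h)
            else if cartan u x y = 0 then rt ?u y else (\<lambda>h. rt ?u y h + rt ?u x h))"
          by (subst isotropic_reflexion_def) (simp add: cartan)
        then show "rt (isotropic_reflexion ?u x) y = rt u y"
          by (simp add: isotropic_reflexion_def)
      qed
    qed
    then show ?thesis
      using True cartan by (simp add: reflexion_def)
  qed
qed

text \<open>Reflectability sees only row x of the Cartan matrix and the parity of x; on an isotropic
  x it only asks for odd parity, which is kept.\<close>

lemma reflectable_reflexion:
  fixes u :: "('h::ab_group_add, 'x::finite) root_data"
  assumes "is_root_datum u" "reflectable u x"
  shows "reflectable (reflexion u x) x"
proof (cases "cartan u x x = 0")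
  case True
  then show ?thesis
    using assms(2) cartan_reflexion_same [OF assms(1), of x]
    by (simp add: reflectable_def reflexion_def) (simp add: isotropic_reflexion_def)
next
  case False
  have "par (anisotropic_reflexion u x) = par u" by (simp add: anisotropic_reflexion_def)
  then show ?thesis
    using assms(2) False cartan_anisotropic_reflexion [OF assms(1) False]
    by (simp add: reflectable_def reflexion_def)
qed

section \<open>Chains of reflexions\<close>

lemma Sk_trans: "u' \<in> Sk u \<Longrightarrow> u \<in> Sk v \<Longrightarrow> u' \<in> Sk v"
  by (induction rule: Sk.induct) (auto intro: Sk_step)

lemma Sk_root_datum:
  fixes v :: "('h::ab_group_add, 'x::finite) root_data"
  shows "u \<in> Sk v \<Longrightarrow> is_root_datum v \<Longrightarrow> is_root_datum u \<and> smult u = smult v"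
  by (induction rule: Sk.induct) (auto intro: is_root_datum_reflexion)

lemma Sk_sym:
  fixes v :: "('h::ab_group_add, 'x::finite) root_data"
  shows "u \<in> Sk v \<Longrightarrow> is_root_datum v \<Longrightarrow> v \<in> Sk u"
proof (induction rule: Sk.induct)
  case (Sk_step u x)
  then have u: "is_root_datum u" using Sk_root_datum by blast
  have "u \<in> Sk (reflexion u x)"
    using Sk.Sk_step [OF Sk_base reflectable_reflexion [OF u Sk_step.hyps(2)]]
    by (simp add: reflexion_reflexion [OF u])
  with Sk_step show ?case using Sk_trans by blast
qed (rule Sk_base)

lemma Sp_subset_Sk: "u \<in> Sp v \<Longrightarrow> u \<in> Sk v"
  by (induction rule: Sp.induct) (auto intro: Sk_base Sk_step)

text \<open>Reflexions induce the identity, so admissibility compares vertices of the skeleton by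
  isomorphisms that fix the Cartan space pointwise.\<close>

lemma Sk_arrow:
  fixes v :: "('h::ab_group_add, 'x::finite) root_data"
  shows "u \<in> Sk v \<Longrightarrow> is_root_datum v \<Longrightarrow> arrow v u id"
proof (induction rule: Sk.induct)
  case (Sk_step u x)
  then have "arrow v u id" "is_root_datum u" using Sk_root_datum by blast+
  then show ?case
    using arrow_comp [OF _ arrow_reflexion [OF _ Sk_step.hyps(2)], of v id] by (simp only: id_o)
qed (rule arrow_refl)

subsection \<open>Linear automorphisms\<close>

lemma weyl_act_sel [simp]:
  "smult (weyl_act w u) = smult u" "par (weyl_act w u) = par u"
  "cor (weyl_act w u) y = w (cor u y)" "rt (weyl_act w u) y = rt u y \<circ> inv w"
  by (simp_all add: weyl_act_def)

lemma weyl_act_id: "weyl_act id u = u"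
  by (rule root_datum_eqI) (simp_all add: fun_eq_iff)

lemma weyl_act_comp:
  assumes "bij w" "bij w'" shows "weyl_act (w \<circ> w') u = weyl_act w (weyl_act w' u)"
  by (rule root_datum_eqI) (simp_all add: fun_eq_iff o_inv_distrib [OF assms])

lemma cartan_weyl_act: "bij w \<Longrightarrow> cartan (weyl_act w u) = cartan u"
  by (simp add: cartan_def fun_eq_iff bij_is_inj)

lemma reflectable_weyl_act: "bij w \<Longrightarrow> reflectable (weyl_act w u) x = reflectable u x"
  by (simp add: reflectable_def cartan_weyl_act)

lemma anisotropic_at_weyl_act: "bij w \<Longrightarrow> anisotropic_at (weyl_act w u) x = anisotropic_at u x"
  by (simp add: anisotropic_at_def cartan_weyl_act reflectable_weyl_act)

text \<open>The coefficients of a reflexion are built from Cartan entries, which a linear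
  automorphism does not change.\<close>

lemma reflexion_weyl_act:
  assumes "bij w" "Vector_Spaces.linear (smult u) (smult u) w"
  shows "reflexion (weyl_act w u) x = weyl_act w (reflexion u x)"
proof -
  interpret Vector_Spaces.linear "smult u" "smult u" w by (rule assms(2))
  show ?thesis
  proof (rule root_datum_eqI)
    show "cor (reflexion (weyl_act w u) x) = cor (weyl_act w (reflexion u x))"
      by (rule ext) (simp add: reflexion_def anisotropic_reflexion_def isotropic_reflexion_def
          cartan_weyl_act [OF assms(1)] add diff neg scale)
    show "rt (reflexion (weyl_act w u) x) = rt (weyl_act w (reflexion u x))"
      by (rule ext) (simp add: reflexion_def anisotropic_reflexion_def isotropic_reflexion_def
          cartan_weyl_act [OF assms(1)] fun_eq_iff)
    show "par (reflexion (weyl_act w u) x) = par (weyl_act w (reflexion u x))"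
      by (rule ext) (simp add: reflexion_def anisotropic_reflexion_def isotropic_reflexion_def
          cartan_weyl_act [OF assms(1)])
  qed simp
qed

lemma nonneg_span_weyl_act:
  assumes "bij w"
  shows "nonneg_span (weyl_act w u) \<beta> \<longleftrightarrow> nonneg_span u (\<beta> \<circ> w)"
proof -
  have "\<beta> = (\<lambda>h. \<Sum>x\<in>UNIV. of_nat (n x) * rt (weyl_act w u) x h) \<longleftrightarrow>
      \<beta> \<circ> w = (\<lambda>h. \<Sum>x\<in>UNIV. of_nat (n x) * rt u x h)" for n
  proof
    assume *: "\<beta> \<circ> w = (\<lambda>h. \<Sum>x\<in>UNIV. of_nat (n x) * rt u x h)"
    have "\<beta> h = (\<beta> \<circ> w) (inv w h)" for h
      using assms by (simp add: surj_f_inv_f bij_is_surj)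
    then show "\<beta> = (\<lambda>h. \<Sum>x\<in>UNIV. of_nat (n x) * rt (weyl_act w u) x h)"
      unfolding * by (simp add: fun_eq_iff)
  qed (use assms in \<open>simp add: fun_eq_iff bij_is_inj\<close>)
  then show ?thesis by (simp only: nonneg_span_def)
qed

subsection \<open>Anisotropic roots and the Weyl group\<close>

text \<open>The interface between algebra and combinatorics: inside this locale, \<open>sign\<close>
  and \<open>proportional\<close> are all that is known from admissibility.\<close>

locale skeleton =
  fixes v :: "('h::ab_group_add, 'x::finite) root_data"
  assumes datum: "is_root_datum v"
    and sign: "u \<in> Sk v \<Longrightarrow> u' \<in> Sk v \<Longrightarrow>
      nonneg_span u' (rt u x) \<or> nonneg_span u' (\<lambda>h. - rt u x h)"
    and proportional: "u \<in> Sk v \<Longrightarrow> u' \<in> Sk v \<Longrightarrow> rt u x = rt u' x' \<Longrightarrow>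
      \<exists>c. cor u x = smult v c (cor u' x')"
begin

abbreviation "S \<equiv> smult v"
abbreviation "\<Delta> \<equiv> anisotropic_roots v"
abbreviation "P \<equiv> positive_anisotropic v"
abbreviation "\<Pi> \<equiv> principal_roots v"
abbreviation "s \<equiv> root_reflection v"

definition word_prod :: "('h \<Rightarrow> complex) list \<Rightarrow> 'h \<Rightarrow> 'h" where
  "word_prod \<alpha>s = foldr (\<lambda>\<alpha> f. s \<alpha> \<circ> f) \<alpha>s id"

lemma word_prod_simps [simp]:
  "word_prod [] = id" "word_prod (\<alpha> # \<alpha>s) = s \<alpha> \<circ> word_prod \<alpha>s"
  by (simp_all add: word_prod_def)

lemma word_prod_append: "word_prod (\<alpha>s @ \<beta>s) = word_prod \<alpha>s \<circ> word_prod \<beta>s"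
  by (induction \<alpha>s) (simp_all add: o_assoc)

lemma Sk_datum: "u \<in> Sk v \<Longrightarrow> is_root_datum u" and Sk_smult: "u \<in> Sk v \<Longrightarrow> smult u = S"
  using Sk_root_datum datum by blast+

lemma anisotropic_rootE:
  assumes "\<alpha> \<in> \<Delta>"
  obtains u x where "u \<in> Sk v" "anisotropic_at u x" "\<alpha> = rt u x"
  using assms by (auto simp: anisotropic_roots_def)

lemma anisotropic_rootI: "u \<in> Sk v \<Longrightarrow> anisotropic_at u x \<Longrightarrow> rt u x \<in> \<Delta>"
  by (auto simp: anisotropic_roots_def)

text \<open>Replacing a(x) by \<open>k\<close> times itself multiplies the diagonal Cartan entry by
  \<open>k\<close> as well, so the normalized vector is the same at every vertex where the root is
  simple.\<close>

lemma coroot_eq: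
  assumes "u \<in> Sk v" "anisotropic_at u x"
  shows "coroot v (rt u x) = S (2 / cartan u x x) (cor u x)"
  unfolding coroot_def
proof (rule the_equality)
  show "\<exists>u'\<in>Sk v. \<exists>x'. anisotropic_at u' x' \<and> rt u' x' = rt u x \<and>
      S (2 / cartan u x x) (cor u x) = smult u' (2 / cartan u' x' x') (cor u' x')"
    using assms Sk_smult by (metis (no_types))
next
  interpret vector_space S by (rule vector_space_smult [OF datum])
  fix c assume "\<exists>u'\<in>Sk v. \<exists>x'. anisotropic_at u' x' \<and> rt u' x' = rt u x \<and>
      c = smult u' (2 / cartan u' x' x') (cor u' x')"
  then obtain u' x' where u': "u' \<in> Sk v" "anisotropic_at u' x'" "rt u' x' = rt u x"
    and c: "c = S (2 / cartan u' x' x') (cor u' x')" using Sk_smult by metis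
  obtain k where k: "cor u' x' = S k (cor u x)" using proportional [OF u'(1) assms(1) u'(3)] by blast
  have "cartan u' x' x' = k * cartan u x x"
    using rt_linear(4) [OF Sk_datum [OF assms(1)], of x k "cor u x"] Sk_smult [OF assms(1)]
    by (simp add: cartan_def u'(3) k)
  moreover have "cartan u' x' x' \<noteq> 0" using u'(2) by (simp add: anisotropic_at_def)
  ultimately show "c = S (2 / cartan u x x) (cor u x)"
    by (auto simp: c k)
qed

lemma root_linear: "\<alpha> \<in> \<Delta> \<Longrightarrow> Vector_Spaces.linear S (*) \<alpha>"
  by (metis anisotropic_rootE linear_rt Sk_datum Sk_smult)

lemma root_coroot: assumes "\<alpha> \<in> \<Delta>" shows "\<alpha> (coroot v \<alpha>) = 2"
proof -
  obtain u x where u: "u \<in> Sk v" "anisotropic_at u x" "\<alpha> = rt u x"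
    using anisotropic_rootE [OF assms] .
  show ?thesis
    using u(2) rt_linear(4) [OF Sk_datum [OF u(1)], of x _ "cor u x"] Sk_smult [OF u(1)]
    by (simp add: u(3) coroot_eq [OF u(1,2)]) (simp add: cartan_def anisotropic_at_def)
qed

lemma reflection_linear: assumes "\<alpha> \<in> \<Delta>" shows "Vector_Spaces.linear S S (s \<alpha>)"
proof -
  interpret vector_space S by (rule vector_space_smult [OF datum])
  interpret \<alpha>: Vector_Spaces.linear S "(*)" \<alpha> by (rule root_linear [OF assms])
  show ?thesis
    by unfold_locales
      (simp_all add: root_reflection_def \<alpha>.add \<alpha>.scale scale_left_distrib scale_right_diff_distrib)
qed

lemma root_reflection_root:
  assumes "\<alpha> \<in> \<Delta>" shows "\<alpha> (s \<alpha> h) = - \<alpha> h"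
proof -
  interpret \<alpha>: Vector_Spaces.linear S "(*)" \<alpha> by (rule root_linear [OF assms])
  show ?thesis by (simp add: root_reflection_def \<alpha>.diff \<alpha>.scale root_coroot [OF assms])
qed

lemma reflection_invol: assumes "\<alpha> \<in> \<Delta>" shows "s \<alpha> \<circ> s \<alpha> = id"
proof
  fix h
  interpret vector_space S by (rule vector_space_smult [OF datum])
  have "s \<alpha> (s \<alpha> h) = s \<alpha> h - S (\<alpha> (s \<alpha> h)) (coroot v \<alpha>)"
    by (simp add: root_reflection_def [of v \<alpha> "s \<alpha> h"])
  then show "(s \<alpha> \<circ> s \<alpha>) h = id h"
    by (simp add: root_reflection_root [OF assms]) (simp add: root_reflection_def)
qed

lemma reflection_bij: "\<alpha> \<in> \<Delta> \<Longrightarrow> bij (s \<alpha>)"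
  using reflection_invol o_bij by blast

lemma inv_reflection: "\<alpha> \<in> \<Delta> \<Longrightarrow> inv (s \<alpha>) = s \<alpha>"
  using inv_unique_comp [OF reflection_invol reflection_invol] .

lemma word_linear: "set \<alpha>s \<subseteq> \<Delta> \<Longrightarrow> Vector_Spaces.linear S S (word_prod \<alpha>s)"
proof (induction \<alpha>s)
  case Nil
  interpret vector_space S by (rule vector_space_smult [OF datum])
  show "Vector_Spaces.linear S S (word_prod [])" using linear_id by simp
next
  case (Cons \<alpha> \<alpha>s)
  then have "Vector_Spaces.linear S S (word_prod \<alpha>s)" "Vector_Spaces.linear S S (s \<alpha>)"
    using reflection_linear by simp_all
  from Vector_Spaces.linear_compose [OF this]
  show "Vector_Spaces.linear S S (word_prod (\<alpha> # \<alpha>s))" by simp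
qed

lemma word_bij: "set \<alpha>s \<subseteq> \<Delta> \<Longrightarrow> bij (word_prod \<alpha>s)"
  by (induction \<alpha>s) (auto intro!: bij_comp reflection_bij)

lemma inv_word: "set \<alpha>s \<subseteq> \<Delta> \<Longrightarrow> inv (word_prod \<alpha>s) = word_prod (rev \<alpha>s)"
proof (induction \<alpha>s)
  case (Cons \<alpha> \<alpha>s)
  then have "inv (word_prod (\<alpha> # \<alpha>s)) = word_prod (rev \<alpha>s) \<circ> s \<alpha>"
    using o_inv_distrib [OF reflection_bij word_bij, of \<alpha> \<alpha>s]
    by (simp add: inv_reflection)
  then show "inv (word_prod (\<alpha> # \<alpha>s)) = word_prod (rev (\<alpha> # \<alpha>s))"
    by (simp add: word_prod_append)
next
  show "inv (word_prod []) = word_prod (rev [])" by simp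
qed

section \<open>Reflections acting on the skeleton\<close>

lemma reflexion_reflection:
  assumes "u \<in> Sk v" "anisotropic_at u x"
  shows "reflexion u x = weyl_act (s (rt u x)) u"
proof -
  let ?\<alpha> = "rt u x"
  interpret vector_space S by (rule vector_space_smult [OF datum])
  have \<alpha>: "?\<alpha> \<in> \<Delta>" using anisotropic_rootI assms .
  have aniso: "cartan u x x \<noteq> 0" using assms(2) by (simp add: anisotropic_at_def)
  have smult: "smult u = S" using Sk_smult assms(1) .
  have s: "s ?\<alpha> h = h - S (2 * rt u x h / cartan u x x) (cor u x)" for h
    by (simp add: root_reflection_def coroot_eq [OF assms] mult.commute)
  show ?thesis
  proof (rule root_datum_eqI)
    show "cor (reflexion u x) = cor (weyl_act (s ?\<alpha>) u)"
      using aniso by (simp add: fun_eq_iff reflexion_def anisotropic_reflexion_def s smult)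
        (simp add: cartan_def)
    show "rt (reflexion u x) = rt (weyl_act (s ?\<alpha>) u)"
      using aniso rt_linear(2,4) [OF Sk_datum [OF assms(1)]]
      by (simp add: fun_eq_iff reflexion_def anisotropic_reflexion_def inv_reflection [OF \<alpha>] s smult)
        (simp add: cartan_def)
  qed (use aniso in \<open>simp_all add: reflexion_def anisotropic_reflexion_def\<close>)
qed

text \<open>At a vertex u where \<alpha> is simple the reflection is a reflexion. Since it commutes
  with reflexions, the claim spreads along a chain from u to u'; this is why the chain starts at u
  and not at v.\<close>

lemma reflection_Sk:
  assumes "\<alpha> \<in> \<Delta>" "u' \<in> Sk v" shows "weyl_act (s \<alpha>) u' \<in> Sk v"
proof -
  obtain u x where u: "u \<in> Sk v" "anisotropic_at u x" "\<alpha> = rt u x"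
    using anisotropic_rootE [OF assms(1)] .
  have "u' \<in> Sk u" using Sk_trans [OF assms(2) Sk_sym [OF u(1) datum]] .
  then show ?thesis
  proof (induction rule: Sk.induct)
    case Sk_base
    show ?case
      using u reflexion_reflection [OF u(1,2)] Sk_step [OF u(1), of x] by (simp add: anisotropic_at_def)
  next
    case (Sk_step w y)
    have "w \<in> Sk v" using Sk_trans Sk_step.hyps(1) u(1) .
    then have "Vector_Spaces.linear (smult w) (smult w) (s \<alpha>)"
      using reflection_linear [OF assms(1)] Sk_smult by simp
    then have "weyl_act (s \<alpha>) (reflexion w y) = reflexion (weyl_act (s \<alpha>) w) y"
      by (rule reflexion_weyl_act [OF reflection_bij [OF assms(1)], symmetric])
    then show ?case
      using Sk.Sk_step [OF Sk_step.IH, of y] Sk_step.hyps(2)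
      by (simp add: reflectable_weyl_act reflection_bij [OF assms(1)])
  qed
qed

lemma word_Sk: "set \<alpha>s \<subseteq> \<Delta> \<Longrightarrow> u \<in> Sk v \<Longrightarrow> weyl_act (word_prod \<alpha>s) u \<in> Sk v"
  by (induction \<alpha>s)
    (auto simp: weyl_act_id weyl_act_comp [OF reflection_bij word_bij] intro: reflection_Sk)

lemma word_root: "set \<alpha>s \<subseteq> \<Delta> \<Longrightarrow> \<beta> \<in> \<Delta> \<Longrightarrow> \<beta> \<circ> inv (word_prod \<alpha>s) \<in> \<Delta>"
  by (elim anisotropic_rootE)
    (metis anisotropic_rootI word_Sk word_bij anisotropic_at_weyl_act weyl_act_sel(4))

lemma word_root': "set \<alpha>s \<subseteq> \<Delta> \<Longrightarrow> \<beta> \<in> \<Delta> \<Longrightarrow> \<beta> \<circ> word_prod \<alpha>s \<in> \<Delta>"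
  using word_root [of "rev \<alpha>s" \<beta>] inv_word [of "rev \<alpha>s"] by simp

lemma reflection_root: "\<alpha> \<in> \<Delta> \<Longrightarrow> \<beta> \<in> \<Delta> \<Longrightarrow> \<beta> \<circ> s \<alpha> \<in> \<Delta>"
  using word_root' [of "[\<alpha>]" \<beta>] by simp

text \<open>The word w carries a vertex where \<beta> is simple to one where w(\<beta>) is simple,
  and hence coroot to coroot.\<close>

lemma reflection_conjugate:
  assumes "set \<alpha>s \<subseteq> \<Delta>" "\<beta> \<in> \<Delta>"
  shows "s (\<beta> \<circ> inv (word_prod \<alpha>s)) = word_prod \<alpha>s \<circ> s \<beta> \<circ> inv (word_prod \<alpha>s)"
proof -
  let ?w = "word_prod \<alpha>s"
  interpret w: Vector_Spaces.linear S S ?w by (rule word_linear [OF assms(1)])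
  have bij: "bij ?w" by (rule word_bij [OF assms(1)])
  obtain u x where u: "u \<in> Sk v" "anisotropic_at u x" "\<beta> = rt u x"
    using anisotropic_rootE [OF assms(2)] .
  have "coroot v (\<beta> \<circ> inv ?w) = ?w (coroot v \<beta>)"
    using coroot_eq [OF word_Sk [OF assms(1) u(1)], of x] u
    by (simp add: anisotropic_at_weyl_act cartan_weyl_act bij coroot_eq w.scale)
  then show ?thesis
    using bij by (simp add: fun_eq_iff root_reflection_def w.diff w.scale surj_f_inv_f bij_is_surj)
qed

lemma reflection_conjugate':
  assumes "\<alpha> \<in> \<Delta>" "\<beta> \<in> \<Delta>" shows "s (\<beta> \<circ> s \<alpha>) = s \<alpha> \<circ> s \<beta> \<circ> s \<alpha>"
  using reflection_conjugate [of "[\<alpha>]" \<beta>] assms by (simp add: inv_reflection)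

lemma weyl_group_word:
  assumes "w \<in> weyl_group v" shows "\<exists>\<alpha>s. set \<alpha>s \<subseteq> \<Delta> \<and> w = word_prod \<alpha>s"
  using assms
proof induction
  case weyl_id
  then show ?case by (intro exI [of _ "[]"]) simp
next
  case (weyl_gen \<alpha>)
  then show ?case by (intro exI [of _ "[\<alpha>]"]) simp
next
  case (weyl_comp w w')
  then obtain \<alpha>s \<beta>s where "set \<alpha>s \<subseteq> \<Delta>" "w = word_prod \<alpha>s" "set \<beta>s \<subseteq> \<Delta>" "w' = word_prod \<beta>s"
    by blast
  then show ?case by (intro exI [of _ "\<alpha>s @ \<beta>s"]) (simp add: word_prod_append)
next
  case (weyl_inv w)
  then obtain \<alpha>s where "set \<alpha>s \<subseteq> \<Delta>" "w = word_prod \<alpha>s" by blast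
  then show ?case by (intro exI [of _ "rev \<alpha>s"]) (simp add: inv_word)
qed

lemma word_weyl_group: "set \<alpha>s \<subseteq> \<Delta> \<Longrightarrow> word_prod \<alpha>s \<in> weyl_group v"
  by (induction \<alpha>s) (auto intro: weyl_group.intros)

section \<open>Generation by principal reflections\<close>

lemma principal_subset: "\<Pi> \<subseteq> \<Delta>"
  by (auto simp: principal_roots_def)

lemma Sk_decomposition:
  assumes "u \<in> Sk v"
  shows "\<exists>u'\<in>Sp v. \<exists>\<beta>s. set \<beta>s \<subseteq> \<Pi> \<and> u = weyl_act (word_prod \<beta>s) u'"
  using assms
proof (induction rule: Sk.induct)
  case Sk_base
  show ?case
    by (intro bexI [OF _ Sp_base] exI [of _ "[]"]) (simp add: weyl_act_id [unfolded id_def])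
next
  case (Sk_step u x)
  then obtain u' \<beta>s where u': "u' \<in> Sp v" "set \<beta>s \<subseteq> \<Pi>" "u = weyl_act (word_prod \<beta>s) u'"
    by blast
  let ?w = "word_prod \<beta>s"
  have \<beta>s: "set \<beta>s \<subseteq> \<Delta>" using u'(2) principal_subset by blast
  have Sk: "u' \<in> Sk v" by (rule Sp_subset_Sk [OF u'(1)])
  have bij: "bij ?w" by (rule word_bij [OF \<beta>s])
  have x: "reflectable u' x" using Sk_step.hyps(2) by (simp add: u'(3) reflectable_weyl_act bij)
  have eq: "reflexion u x = weyl_act ?w (reflexion u' x)"
    unfolding u'(3) by (rule reflexion_weyl_act [OF bij]) (simp add: Sk_smult [OF Sk] word_linear [OF \<beta>s])
  show ?case
  proof (cases "cartan u' x x = 0")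
    case True
    then show ?thesis using Sp_step [OF u'(1) x] u'(2) eq by blast
  next
    case False
    then have aniso: "anisotropic_at u' x" using x by (simp add: anisotropic_at_def)
    then have \<alpha>: "rt u' x \<in> \<Pi>"
      using anisotropic_rootI [OF Sk] u'(1) by (auto simp: principal_roots_def)
    \<comment> \<open>The new letter goes to the right: r_x(w(u')) = w(r_x(u')) = w(s_\<alpha>(u')),
      where \<alpha> is simple at the spine vertex u' and therefore principal.\<close>
    have "reflexion u x = weyl_act (word_prod (\<beta>s @ [rt u' x])) u'"
      using \<alpha> principal_subset
      by (simp add: eq reflexion_reflection [OF Sk aniso] word_prod_append subset_iff
          weyl_act_comp [OF bij reflection_bij])
    then show ?thesis
      by (intro bexI [OF _ u'(1)] exI [of _ "\<beta>s @ [rt u' x]"]) (use u'(2) \<alpha> in simp)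
  qed
qed

text \<open>\<alpha> is w applied to a root that is simple on the spine, with w a word in principal
  reflections; so s_\<alpha> is a conjugate by w of a principal reflection.\<close>

lemma reflection_principal_word:
  assumes "\<alpha> \<in> \<Delta>" shows "\<exists>\<beta>s. set \<beta>s \<subseteq> \<Pi> \<and> s \<alpha> = word_prod \<beta>s"
proof -
  obtain u x where u: "u \<in> Sk v" "anisotropic_at u x" "\<alpha> = rt u x"
    using anisotropic_rootE [OF assms(1)] .
  obtain u' \<beta>s where u': "u' \<in> Sp v" "set \<beta>s \<subseteq> \<Pi>" "u = weyl_act (word_prod \<beta>s) u'"
    using Sk_decomposition [OF u(1)] by blast
  have \<beta>s: "set \<beta>s \<subseteq> \<Delta>" using u'(2) principal_subset by blast
  have aniso: "anisotropic_at u' x"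
    using u(2) by (simp add: u'(3) anisotropic_at_weyl_act word_bij [OF \<beta>s])
  then have \<beta>: "rt u' x \<in> \<Pi>"
    using anisotropic_rootI [OF Sp_subset_Sk [OF u'(1)]] u'(1) by (auto simp: principal_roots_def)
  then have "s \<alpha> = word_prod (\<beta>s @ [rt u' x] @ rev \<beta>s)"
    using reflection_conjugate [OF \<beta>s, of "rt u' x"] principal_subset
    by (simp add: u(3) u'(3) word_prod_append inv_word [OF \<beta>s] subset_iff o_assoc)
  then show ?thesis
    by (intro exI [of _ "\<beta>s @ [rt u' x] @ rev \<beta>s"]) (use \<beta> u'(2) in simp)
qed

lemma weyl_group_principal_word:
  assumes "w \<in> weyl_group v" shows "\<exists>\<beta>s. set \<beta>s \<subseteq> \<Pi> \<and> w = word_prod \<beta>s"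
proof -
  have "set \<alpha>s \<subseteq> \<Delta> \<Longrightarrow> \<exists>\<beta>s. set \<beta>s \<subseteq> \<Pi> \<and> word_prod \<alpha>s = word_prod \<beta>s" for \<alpha>s
  proof (induction \<alpha>s)
    case Nil
    show ?case by (intro exI [of _ "[]"]) simp
  next
    case (Cons \<alpha> \<alpha>s)
    then obtain \<beta>s \<gamma>s where "set \<beta>s \<subseteq> \<Pi>" "word_prod \<alpha>s = word_prod \<beta>s"
      "set \<gamma>s \<subseteq> \<Pi>" "s \<alpha> = word_prod \<gamma>s"
      using reflection_principal_word by (metis list.set_intros(1) set_subset_Cons subset_trans subsetD)
    then show ?case by (intro exI [of _ "\<gamma>s @ \<beta>s"]) (simp add: word_prod_append)
  qed
  then show ?thesis using weyl_group_word [OF assms] by blast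
qed

subsection \<open>Positive anisotropic roots\<close>

lemma positive_iff: "\<beta> \<in> P u \<longleftrightarrow> \<beta> \<in> \<Delta> \<and> nonneg_span u \<beta>"
  by (simp add: positive_anisotropic_def nonneg_span_def)

lemma root_nonneg: "\<beta> \<in> \<Delta> \<Longrightarrow> u \<in> Sk v \<Longrightarrow> nonneg_span u \<beta> \<or> nonneg_span u (\<lambda>h. - \<beta> h)"
  using sign by (elim anisotropic_rootE) blast

lemma root_uminus: assumes "\<beta> \<in> \<Delta>" shows "(\<lambda>h. - \<beta> h) \<in> \<Delta>"
proof -
  have "(\<lambda>h. - \<beta> h) = \<beta> \<circ> s \<beta>" using root_reflection_root [OF assms] by (simp add: fun_eq_iff)
  then show ?thesis using reflection_root [OF assms assms] by simp
qed

lemma nonneg_both: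
  fixes u :: "('h, 'x) root_data"
  assumes "is_root_datum u" "nonneg_span u \<beta>" "nonneg_span u (\<lambda>h. - \<beta> h)"
  shows "\<beta> = (\<lambda>_. 0)"
proof -
  obtain n m :: "'x \<Rightarrow> nat" where n: "\<beta> = (\<lambda>h. \<Sum>y\<in>UNIV. of_nat (n y) * rt u y h)"
    and m: "(\<lambda>h. - \<beta> h) = (\<lambda>h. \<Sum>y\<in>UNIV. of_nat (m y) * rt u y h)"
    using assms(2,3) by (auto simp: nonneg_span_def)
  have "(\<Sum>y\<in>UNIV. of_nat (n y + m y) * rt u y h) = 0" for h
  proof -
    have "(\<Sum>y\<in>UNIV. of_nat (n y + m y) * rt u y h) =
        (\<Sum>y\<in>UNIV. of_nat (n y) * rt u y h) + (\<Sum>y\<in>UNIV. of_nat (m y) * rt u y h)"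
      by (simp add: distrib_right sum.distrib)
    then show ?thesis
      using fun_cong [OF n, of h] fun_cong [OF m, of h] by (metis add.right_inverse)
  qed
  from rt_independent [OF assms(1) this] have "of_nat (n y + m y) = (0::complex)" for y .
  then have "n y = 0" for y by (simp only: of_nat_eq_0_iff add_is_0)
  then show ?thesis by (simp add: n)
qed

lemma positive_uminus:
  assumes "\<beta> \<in> \<Delta>" "u \<in> Sk v" shows "(\<lambda>h. - \<beta> h) \<in> P u \<longleftrightarrow> \<beta> \<notin> P u"
proof -
  have "\<beta> \<noteq> (\<lambda>_. 0)" using root_coroot [OF assms(1)] by auto
  then show ?thesis
    using nonneg_both [OF Sk_datum [OF assms(2)], of \<beta>] root_nonneg [OF assms] root_uminus [OF assms(1)]
      assms(1) by (auto simp: positive_iff)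
qed

text \<open>At a vertex w where \<beta> is simple, b_u(x) has integer coefficients k of one sign
  \<epsilon>. Comparing the coefficient of \<beta> itself gives 1 = \<epsilon> n k, which forces n =
  1.\<close>

lemma multiple_of_simple:
  assumes "\<beta> \<in> \<Delta>" "u \<in> Sk v" "\<beta> = (\<lambda>h. of_nat n * rt u x h)"
  shows "\<beta> = rt u x"
proof -
  obtain w z where w: "w \<in> Sk v" "anisotropic_at w z" "\<beta> = rt w z"
    using anisotropic_rootE [OF assms(1)] .
  obtain \<epsilon> :: complex and k :: "'x \<Rightarrow> nat"
    where \<epsilon>: "\<epsilon> = 1 \<or> \<epsilon> = - 1"
      and k: "\<And>h. rt u x h = (\<Sum>y\<in>UNIV. (\<epsilon> * of_nat (k y)) * rt w y h)"
  proof (cases "nonneg_span w (rt u x)")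
    case True
    then obtain k :: "'x \<Rightarrow> nat" where "rt u x = (\<lambda>h. \<Sum>y\<in>UNIV. of_nat (k y) * rt w y h)"
      by (auto simp: nonneg_span_def)
    then show ?thesis by (intro that [of 1 k]) simp_all
  next
    case False
    then obtain k :: "'x \<Rightarrow> nat" where "(\<lambda>h. - rt u x h) = (\<lambda>h. \<Sum>y\<in>UNIV. of_nat (k y) * rt w y h)"
      using sign [OF assms(2) w(1), of x] by (auto simp: nonneg_span_def)
    then have "rt u x h = - (\<Sum>y\<in>UNIV. of_nat (k y) * rt w y h)" for h
      by (metis minus_minus)
    then show ?thesis by (intro that [of "- 1" k]) (simp_all add: sum_negf)
  qed
  have "(\<Sum>y\<in>UNIV. (if y = z then 1 else 0) * rt w y h)
      = (\<Sum>y\<in>UNIV. (of_nat n * (\<epsilon> * of_nat (k y))) * rt w y h)" for h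
    using fun_cong [OF assms(3), of h]
    by (simp only: w(3) rt_as_sum [symmetric] k sum_distrib_left mult.assoc)
  from rt_independent_eq [OF Sk_datum [OF w(1)] this, of z]
  have nk: "1 = \<epsilon> * of_nat (n * k z)" by (simp add: mult.left_commute)
  have "n * k z = 1"
    using \<epsilon>
  proof
    assume "\<epsilon> = 1"
    then show ?thesis using nk by (metis mult_1 of_nat_eq_1_iff)
  next
    assume "\<epsilon> = - 1"
    have "of_nat (n * k z) + 1 = (0 :: complex)"
      using nk unfolding \<open>\<epsilon> = - 1\<close> by algebra
    then have "of_nat (n * k z + 1) = (0 :: complex)" by (simp only: of_nat_add of_nat_1)
    then show ?thesis by (simp only: of_nat_eq_0_iff)
  qed
  then show ?thesis using assms(3) by simp
qed

text \<open>Were \<beta> negative at u', adding the expansions of \<beta> at u and -\<beta> at u'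
  would give a relation whose coefficients outside x are sums of two natural numbers. They vanish,
  so \<beta> is a multiple of b_u(x). The shifts d may be any complex numbers, which covers
  isotropic reflexions and s_\<alpha> alike.\<close>

lemma nonneg_shift:
  assumes "u \<in> Sk v" "u' \<in> Sk v" "\<beta> \<in> \<Delta>" "nonneg_span u \<beta>" "\<beta> \<noteq> rt u x"
    and rt: "\<And>y h. rt u' y h = rt u y h + d y * rt u x h"
  shows "nonneg_span u' \<beta>"
proof (rule ccontr)
  assume "\<not> nonneg_span u' \<beta>"
  then have "nonneg_span u' (\<lambda>h. - \<beta> h)" using root_nonneg assms(2,3) by blast
  then obtain m :: "'x \<Rightarrow> nat" where m: "(\<lambda>h. - \<beta> h) = (\<lambda>h. \<Sum>y\<in>UNIV. of_nat (m y) * rt u' y h)"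
    by (auto simp: nonneg_span_def)
  obtain n :: "'x \<Rightarrow> nat" where n: "\<beta> = (\<lambda>h. \<Sum>y\<in>UNIV. of_nat (n y) * rt u y h)"
    using assms(4) by (auto simp: nonneg_span_def)
  \<comment> \<open>All that the shift contributes lands on the single root b_u(x), with this
    coefficient.\<close>
  let ?K = "\<Sum>y\<in>UNIV. of_nat (m y) * d y"
  have "(\<Sum>y\<in>UNIV. (of_nat (n y + m y) + (if y = x then ?K else 0)) * rt u y h) = 0" for h
  proof -
    have "- \<beta> h = (\<Sum>y\<in>UNIV. of_nat (m y) * rt u y h) + ?K * rt u x h"
      using fun_cong [OF m, of h] by (simp add: rt distrib_left sum.distrib sum_distrib_right mult.assoc)
    moreover have "(\<Sum>y\<in>UNIV. of_nat (n y + m y) * rt u y h) =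
        (\<Sum>y\<in>UNIV. of_nat (n y) * rt u y h) + (\<Sum>y\<in>UNIV. of_nat (m y) * rt u y h)"
      by (simp add: distrib_right sum.distrib)
    ultimately show ?thesis
      unfolding sum_delta_shift fun_cong [OF n, of h] by algebra
  qed
  from rt_independent [OF Sk_datum [OF assms(1)] this]
  have zero: "of_nat (n y + m y) + (if y = x then ?K else 0) = 0" for y .
  have "n y = 0" if "y \<noteq> x" for y
  proof -
    have "of_nat (n y + m y) = (0::complex)" using zero [of y] that by simp
    then show ?thesis by (simp only: of_nat_eq_0_iff add_is_0)
  qed
  then have "(\<Sum>y\<in>UNIV. of_nat (n y) * rt u y h) = (\<Sum>y\<in>UNIV. if y = x then of_nat (n x) * rt u x h else 0)"
    for h by (intro sum.cong) auto
  then have "\<beta> = (\<lambda>h. of_nat (n x) * rt u x h)" by (simp add: n)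
  then have "\<beta> = rt u x" by (rule multiple_of_simple [OF assms(3,1)])
  with assms(5) show False ..
qed

text \<open>Proportional coroots make the diagonal Cartan entries proportional, so isotropy depends
  on the root and not on the vertex. Thus the exception in \<open>nonneg_shift\<close> never occurs
  for an isotropic reflexion.\<close>

lemma isotropic_not_root:
  assumes "u \<in> Sk v" "cartan u x x = 0" shows "rt u x \<notin> \<Delta>"
proof
  assume "rt u x \<in> \<Delta>"
  then obtain w z where w: "w \<in> Sk v" "anisotropic_at w z" "rt w z = rt u x"
    by (metis anisotropic_rootE)
  obtain c where "cor w z = S c (cor u x)" using proportional [OF w(1) assms(1) w(3)] by blast
  then have "cartan w z z = 0"
    using rt_linear(4) [OF Sk_datum [OF assms(1)], of x c "cor u x"] assms(2)
    by (simp add: cartan_def w(3) Sk_smult [OF assms(1)])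
  then show False using w(2) by (simp add: anisotropic_at_def)
qed

lemma positive_isotropic_reflexion:
  assumes "u \<in> Sk v" "reflectable u x" "cartan u x x = 0"
  shows "P (reflexion u x) = P u"
proof -
  let ?u = "reflexion u x"
  have Sk: "?u \<in> Sk v" using Sk_step assms(1,2) .
  have datum: "is_root_datum u" using Sk_datum assms(1) .
  \<comment> \<open>Proved for every such vertex, so that it also applies to the reflected one; as
    the reflexion is an involution, this yields the reverse inclusion.\<close>
  have "P u \<subseteq> P (reflexion u x)"
    if h: "u \<in> Sk v" "reflexion u x \<in> Sk v" "cartan u x x = 0" for u x
  proof
    fix \<beta> assume \<beta>: "\<beta> \<in> P u"
    obtain d where "\<And>y h. rt (reflexion u x) y h = rt u y h + d y * rt u x h"
      using reflexion_shift [OF Sk_datum [OF h(1)]] by metis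
    then have "nonneg_span (reflexion u x) \<beta>"
      using \<beta> isotropic_not_root [OF h(1,3)]
      by (intro nonneg_shift [OF h(1,2), of \<beta> x d]) (auto simp: positive_iff)
    then show "\<beta> \<in> P (reflexion u x)" using \<beta> by (simp add: positive_iff)
  qed
  from this [OF assms(1) Sk assms(3)] this [OF Sk, of x]
  show ?thesis
    using assms cartan_reflexion_same [OF datum] by (simp add: reflexion_reflexion [OF datum])
qed

lemma positive_Sp: "u \<in> Sp v \<Longrightarrow> P u = P v"
  by (induction rule: Sp.induct) (simp_all add: positive_isotropic_reflexion Sp_subset_Sk)

lemma positive_weyl_act:
  assumes "set \<alpha>s \<subseteq> \<Delta>" "u \<in> Sk v" "\<beta> \<in> \<Delta>"
  shows "\<beta> \<in> P (weyl_act (word_prod \<alpha>s) u) \<longleftrightarrow> \<beta> \<circ> word_prod \<alpha>s \<in> P u"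
  using word_root' [OF assms(1,3)] assms(3)
  by (simp add: positive_iff nonneg_span_weyl_act word_bij [OF assms(1)])

lemma principal_positive: "\<alpha> \<in> \<Pi> \<Longrightarrow> \<alpha> \<in> P v"
proof -
  assume \<alpha>: "\<alpha> \<in> \<Pi>"
  then obtain u x where u: "u \<in> Sp v" "\<alpha> = rt u x" by (auto simp: principal_roots_def)
  have "nonneg_span u \<alpha>"
    unfolding nonneg_span_def
    by (intro exI [of _ "\<lambda>y. if y = x then 1 else 0"] ext) (simp add: u(2) rt_as_sum [of u x] if_distrib cong: if_cong)
  then have "\<alpha> \<in> P u" using \<alpha> principal_subset by (auto simp: positive_iff)
  then show "\<alpha> \<in> P v" by (simp add: positive_Sp [OF u(1)])
qed

text \<open>\<alpha> need not be simple at v, but it is at some spine vertex u with the same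
  positive roots. There s_\<alpha>(\<beta>) is positive iff \<beta> is positive at s_\<alpha>(u),
  whose simple roots differ from those of u by multiples of \<alpha>.\<close>

lemma principal_reflection_positive:
  assumes "\<alpha> \<in> \<Pi>" "\<beta> \<in> P v" "\<beta> \<noteq> \<alpha>" shows "\<beta> \<circ> s \<alpha> \<in> P v"
proof -
  obtain u x where u: "u \<in> Sp v" "\<alpha> = rt u x" using assms(1) by (auto simp: principal_roots_def)
  have \<alpha>: "\<alpha> \<in> \<Delta>" using assms(1) principal_subset by blast
  have \<beta>: "\<beta> \<in> \<Delta>" "nonneg_span u \<beta>"
    using assms(2) positive_Sp [OF u(1)] by (auto simp: positive_iff)
  have Sk: "u \<in> Sk v" using Sp_subset_Sk u(1) .
  have "nonneg_span (weyl_act (s \<alpha>) u) \<beta>"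
  proof (rule nonneg_shift [OF Sk reflection_Sk [OF \<alpha> Sk] \<beta>])
    show "\<beta> \<noteq> rt u x" using assms(3) u(2) by simp
    show "rt (weyl_act (s \<alpha>) u) y h = rt u y h + - rt u y (coroot v \<alpha>) * rt u x h" for y h
      using rt_linear(2,4) [OF Sk_datum [OF Sk]] Sk_smult [OF Sk]
      by (simp add: inv_reflection [OF \<alpha>] root_reflection_def) (simp add: u(2))
  qed
  then show ?thesis
    using reflection_root [OF \<alpha> \<beta>(1)] unfolding positive_Sp [OF u(1), symmetric]
    by (simp add: positive_iff nonneg_span_weyl_act reflection_bij [OF \<alpha>])
qed

subsection \<open>Length\<close>

text \<open>Composition with w is the action of w^-1 on the dual space. With this convention a
  reflection multiplied on the left alters the set in a controlled way.\<close>

definition inversions :: "('h \<Rightarrow> 'h) \<Rightarrow> ('h \<Rightarrow> complex) set" where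
  "inversions w = {\<beta> \<in> P v. \<beta> \<circ> w \<notin> P v}"

text \<open>s_\<alpha> permutes the positive roots other than \<alpha> and so matches the two
  inversion sets away from \<alpha>. As it sends \<alpha> to -\<alpha>, exactly one of the two
  elements inverts \<alpha>.\<close>

lemma inversions_reflection:
  assumes "\<alpha> \<in> \<Pi>" "set \<beta>s \<subseteq> \<Pi>"
  shows "inversions (s \<alpha> \<circ> word_prod \<beta>s) - {\<alpha>} = (\<lambda>\<beta>. \<beta> \<circ> s \<alpha>) ` (inversions (word_prod \<beta>s) - {\<alpha>})"
    and "\<alpha> \<in> inversions (s \<alpha> \<circ> word_prod \<beta>s) \<longleftrightarrow> \<alpha> \<notin> inversions (word_prod \<beta>s)"
proof -
  let ?f = "word_prod \<beta>s"
  have \<alpha>: "\<alpha> \<in> \<Delta>" "\<alpha> \<in> P v" using assms(1) principal_subset principal_positive by auto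
  have ss: "\<beta> \<circ> s \<alpha> \<circ> s \<alpha> = \<beta>" for \<beta> :: "'h \<Rightarrow> complex"
    using reflection_invol [OF \<alpha>(1)] by (simp add: comp_assoc)
  have neg: "\<alpha> \<circ> s \<alpha> = (\<lambda>h. - \<alpha> h)"
    using root_reflection_root [OF \<alpha>(1)] by (simp add: fun_eq_iff)
  have not_pos: "\<alpha> \<circ> s \<alpha> \<notin> P v"
    unfolding neg using positive_uminus [OF \<alpha>(1) Sk_base] \<alpha>(2) by simp
  have ne: "\<beta> \<circ> s \<alpha> \<noteq> \<alpha>" if "\<beta> \<in> P v" for \<beta>
  proof
    assume "\<beta> \<circ> s \<alpha> = \<alpha>"
    then have "\<alpha> \<circ> s \<alpha> = \<beta>" using ss [of \<beta>] by simp
    with that not_pos show False by simp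
  qed
  have pos: "\<beta> \<circ> s \<alpha> \<in> P v - {\<alpha>}" if "\<beta> \<in> P v - {\<alpha>}" for \<beta>
    using principal_reflection_positive [OF assms(1), of \<beta>] ne [of \<beta>] that by simp
  have inv: "\<beta> \<in> inversions (s \<alpha> \<circ> ?f) - {\<alpha>} \<longleftrightarrow> \<beta> \<in> P v - {\<alpha>} \<and> \<beta> \<circ> s \<alpha> \<circ> ?f \<notin> P v"
    "\<beta> \<in> inversions ?f - {\<alpha>} \<longleftrightarrow> \<beta> \<in> P v - {\<alpha>} \<and> \<beta> \<circ> ?f \<notin> P v" for \<beta>
    unfolding inversions_def o_assoc by auto
  have image: "\<beta> \<circ> s \<alpha> \<in> inversions (s \<alpha> \<circ> ?f) - {\<alpha>}" if \<beta>: "\<beta> \<in> inversions ?f - {\<alpha>}" for \<beta>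
    unfolding inv ss using iffD1 [OF inv(2) \<beta>] by (elim conjE) (rule conjI [OF pos])
  have preimage: "\<beta> \<circ> s \<alpha> \<in> inversions ?f - {\<alpha>}"
    if \<beta>: "\<beta> \<in> inversions (s \<alpha> \<circ> ?f) - {\<alpha>}" for \<beta>
    unfolding inv using iffD1 [OF inv(1) \<beta>] by (elim conjE) (rule conjI [OF pos])
  show "inversions (s \<alpha> \<circ> ?f) - {\<alpha>} = (\<lambda>\<beta>. \<beta> \<circ> s \<alpha>) ` (inversions ?f - {\<alpha>})"
  proof (intro equalityI subsetI)
    fix \<beta> assume "\<beta> \<in> inversions (s \<alpha> \<circ> ?f) - {\<alpha>}"
    from imageI [OF preimage [OF this], of "\<lambda>\<beta>. \<beta> \<circ> s \<alpha>"]
    show "\<beta> \<in> (\<lambda>\<beta>. \<beta> \<circ> s \<alpha>) ` (inversions ?f - {\<alpha>})" by (simp only: ss)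
  next
    fix \<beta> assume "\<beta> \<in> (\<lambda>\<beta>. \<beta> \<circ> s \<alpha>) ` (inversions ?f - {\<alpha>})"
    then show "\<beta> \<in> inversions (s \<alpha> \<circ> ?f) - {\<alpha>}" by (rule imageE) (simp only: image)
  qed
  have "set \<beta>s \<subseteq> \<Delta>" using assms(2) principal_subset by blast
  then have "\<alpha> \<circ> ?f \<in> \<Delta>" using word_root' \<alpha>(1) by blast
  then have "(\<lambda>h. - (\<alpha> \<circ> ?f) h) \<in> P v \<longleftrightarrow> \<alpha> \<circ> ?f \<notin> P v"
    by (rule positive_uminus [OF _ Sk_base])
  moreover have "\<alpha> \<circ> (s \<alpha> \<circ> ?f) = (\<lambda>h. - (\<alpha> \<circ> ?f) h)"
    unfolding o_assoc neg by (simp add: fun_eq_iff)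
  ultimately show "\<alpha> \<in> inversions (s \<alpha> \<circ> ?f) \<longleftrightarrow> \<alpha> \<notin> inversions ?f"
    using \<alpha>(2) by (simp add: inversions_def)
qed

lemma inversions_id: "inversions id = {}" "inversions (\<lambda>h. h) = {}"
  by (auto simp: inversions_def comp_def)

text \<open>Finiteness comes from the word and not from the positive system, which may be infinite:
  each letter permutes the set away from one root.\<close>

lemma finite_inversions:
  assumes "set \<beta>s \<subseteq> \<Pi>" shows "finite (inversions (word_prod \<beta>s))"
  using assms
proof (induction \<beta>s)
  case (Cons \<alpha> \<beta>s)
  then have "finite (inversions (s \<alpha> \<circ> word_prod \<beta>s) - {\<alpha>})"
    by (subst inversions_reflection(1)) auto
  then show ?case
    by (simp only: word_prod_simps finite_Diff_insert Diff_empty)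
qed (simp add: inversions_id)

lemma card_inversions_reflection:
  assumes "\<alpha> \<in> \<Pi>" "set \<beta>s \<subseteq> \<Pi>"
  shows "card (inversions (s \<alpha> \<circ> word_prod \<beta>s)) =
    (if \<alpha> \<in> inversions (word_prod \<beta>s) then card (inversions (word_prod \<beta>s)) - 1
     else Suc (card (inversions (word_prod \<beta>s))))"
proof -
  let ?f = "word_prod \<beta>s"
  have \<alpha>: "\<alpha> \<in> \<Delta>" using assms(1) principal_subset by blast
  have "inj_on (\<lambda>\<beta> :: 'h \<Rightarrow> complex. \<beta> \<circ> s \<alpha>) A" for A
    by (rule inj_on_inverseI [of _ "\<lambda>\<beta>. \<beta> \<circ> s \<alpha>"])
      (simp only: comp_assoc reflection_invol [OF \<alpha>] comp_id)
  then have card: "card (inversions (s \<alpha> \<circ> ?f) - {\<alpha>}) = card (inversions ?f - {\<alpha>})"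
    unfolding inversions_reflection(1) [OF assms] by (rule card_image)
  have "set (\<alpha> # \<beta>s) \<subseteq> \<Pi>" using assms by simp
  from finite_inversions [OF this] have fin: "finite (inversions (s \<alpha> \<circ> ?f))"
    by (simp only: word_prod_simps)
  show ?thesis
  proof (cases "\<alpha> \<in> inversions ?f")
    case True
    then have "inversions (s \<alpha> \<circ> ?f) - {\<alpha>} = inversions (s \<alpha> \<circ> ?f)"
      using inversions_reflection(2) [OF assms] by blast
    then show ?thesis
      using card card.remove [OF finite_inversions [OF assms(2)] True] True
      by (simp only: if_True diff_Suc_1)
  next
    case False
    then have "\<alpha> \<in> inversions (s \<alpha> \<circ> ?f)" "inversions ?f - {\<alpha>} = inversions ?f"
      using inversions_reflection(2) [OF assms] by blast+
    then show ?thesis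
      using card card.remove [OF fin] False by (simp only: if_False)
  qed
qed

text \<open>If \<alpha> is the first letter, it cancels. Otherwise the reflection passes that letter
  and becomes the one of s_\<beta>(\<alpha>), still positive but perhaps not principal; hence
  \<alpha> ranges over all positive roots. The empty word inverts none.\<close>

lemma exchange:
  assumes "\<alpha> \<in> P v" "set \<beta>s \<subseteq> \<Pi>" "\<alpha> \<circ> word_prod \<beta>s \<notin> P v"
  shows "\<exists>\<gamma>s. set \<gamma>s \<subseteq> \<Pi> \<and> Suc (length \<gamma>s) = length \<beta>s \<and> s \<alpha> \<circ> word_prod \<beta>s = word_prod \<gamma>s"
  using assms
proof (induction \<beta>s arbitrary: \<alpha>)
  case (Cons \<beta> \<beta>s)
  have \<beta>: "\<beta> \<in> \<Pi>" "\<beta> \<in> \<Delta>" and \<beta>s: "set \<beta>s \<subseteq> \<Pi>" using Cons.prems(2) principal_subset by auto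
  have \<alpha>: "\<alpha> \<in> \<Delta>" using Cons.prems(1) by (simp add: positive_iff)
  show ?case
  proof (cases "\<alpha> = \<beta>")
    case True
    have "s \<alpha> \<circ> word_prod (\<beta> # \<beta>s) = word_prod \<beta>s"
      by (simp only: True word_prod_simps o_assoc reflection_invol [OF \<beta>(2)] id_o)
    moreover have "Suc (length \<beta>s) = length (\<beta> # \<beta>s)" by simp
    ultimately show ?thesis using \<beta>s by blast
  next
    case False
    have "\<alpha> \<circ> s \<beta> \<in> P v" using principal_reflection_positive [OF \<beta>(1) Cons.prems(1) False] .
    moreover have "\<alpha> \<circ> s \<beta> \<circ> word_prod \<beta>s \<notin> P v" using Cons.prems(3) by (simp only: word_prod_simps o_assoc not_False_eq_True)
    ultimately obtain \<gamma>s where \<gamma>s: "set \<gamma>s \<subseteq> \<Pi>" "Suc (length \<gamma>s) = length \<beta>s"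
      "s (\<alpha> \<circ> s \<beta>) \<circ> word_prod \<beta>s = word_prod \<gamma>s"
      using Cons.IH \<beta>s by blast
    \<comment> \<open>The reflection in s_\<beta>(\<alpha>) is s_\<beta> s_\<alpha> s_\<beta>, so
      restoring the first letter brings s_\<alpha> back to the front.\<close>
    have "word_prod (\<beta> # \<gamma>s) = s \<beta> \<circ> (s \<beta> \<circ> s \<alpha> \<circ> s \<beta> \<circ> word_prod \<beta>s)"
      by (simp add: \<gamma>s(3) [symmetric] reflection_conjugate' [OF \<beta>(2) \<alpha>])
    also have "\<dots> = s \<alpha> \<circ> word_prod (\<beta> # \<beta>s)"
      using reflection_invol [OF \<beta>(2)] by (simp add: o_assoc)
    finally show ?thesis using \<gamma>s \<beta>(1) by (intro exI [of _ "\<beta> # \<gamma>s"]) simp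
  qed
qed simp

lemma card_inversions_le: "set \<beta>s \<subseteq> \<Pi> \<Longrightarrow> card (inversions (word_prod \<beta>s)) \<le> length \<beta>s"
  by (induction \<beta>s) (auto simp: inversions_id card_inversions_reflection)

text \<open>Letters are prepended one at a time. If \<alpha> is not inverted, word and count both
  grow by one; if it is, the count drops by one and \<open>exchange\<close> supplies a word shorter
  by one.\<close>

lemma reduced_word:
  "set \<beta>s \<subseteq> \<Pi> \<Longrightarrow> \<exists>\<gamma>s. set \<gamma>s \<subseteq> \<Pi> \<and> word_prod \<gamma>s = word_prod \<beta>s \<and>
     length \<gamma>s = card (inversions (word_prod \<beta>s))"
proof (induction \<beta>s)
  case Nil
  show ?case by (intro exI [of _ "[]"]) (simp add: inversions_id)
next
  case (Cons \<alpha> \<beta>s)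
  then obtain \<gamma>s where \<gamma>s: "set \<gamma>s \<subseteq> \<Pi>" "word_prod \<gamma>s = word_prod \<beta>s"
    "length \<gamma>s = card (inversions (word_prod \<beta>s))" by auto
  have \<alpha>: "\<alpha> \<in> \<Pi>" "\<alpha> \<in> P v" and \<beta>s: "set \<beta>s \<subseteq> \<Pi>" using Cons.prems principal_positive by auto
  show ?case
  proof (cases "\<alpha> \<in> inversions (word_prod \<beta>s)")
    case False
    have "word_prod (\<alpha> # \<gamma>s) = word_prod (\<alpha> # \<beta>s)" by (simp only: word_prod_simps \<gamma>s(2))
    moreover have "length (\<alpha> # \<gamma>s) = card (inversions (word_prod (\<alpha> # \<beta>s)))"
      using False by (simp only: word_prod_simps card_inversions_reflection [OF \<alpha>(1) \<beta>s] \<gamma>s(3)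
          if_False list.size add_Suc_right add_0_right)
    moreover have "set (\<alpha> # \<gamma>s) \<subseteq> \<Pi>" using \<gamma>s(1) \<alpha>(1) by simp
    ultimately show ?thesis by blast
  next
    case True
    then have "\<alpha> \<circ> word_prod \<gamma>s \<notin> P v" by (simp add: inversions_def \<gamma>s(2))
    from exchange [OF \<alpha>(2) \<gamma>s(1) this] obtain \<delta>s where \<delta>s: "set \<delta>s \<subseteq> \<Pi>"
      "Suc (length \<delta>s) = length \<gamma>s" "s \<alpha> \<circ> word_prod \<gamma>s = word_prod \<delta>s" by blast
    have "word_prod \<delta>s = word_prod (\<alpha> # \<beta>s)"
      by (simp only: word_prod_simps \<gamma>s(2) \<delta>s(3) [symmetric])
    moreover have "card (inversions (word_prod (\<alpha> # \<beta>s))) = length \<gamma>s - 1"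
      using True by (simp only: word_prod_simps card_inversions_reflection [OF \<alpha>(1) \<beta>s] \<gamma>s(3) if_True)
    then have "length \<delta>s = card (inversions (word_prod (\<alpha> # \<beta>s)))"
      by (simp only: \<delta>s(2) [symmetric] diff_Suc_1)
    ultimately show ?thesis using \<delta>s(1) by blast
  qed
qed

lemma weyl_length_inversions:
  assumes "w \<in> weyl_group v" shows "weyl_length v w = card (inversions w)"
proof -
  obtain \<beta>s where \<beta>s: "set \<beta>s \<subseteq> \<Pi>" "w = word_prod \<beta>s"
    using weyl_group_principal_word [OF assms] by blast
  show ?thesis
    unfolding weyl_length_def word_prod_def [symmetric]
  proof (rule Least_equality)
    show "\<exists>\<alpha>s. length \<alpha>s = card (inversions w) \<and> set \<alpha>s \<subseteq> \<Pi> \<and> w = word_prod \<alpha>s"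
      using reduced_word [OF \<beta>s(1)] \<beta>s(2) by metis
    show "card (inversions w) \<le> n"
      if "\<exists>\<alpha>s. length \<alpha>s = n \<and> set \<alpha>s \<subseteq> \<Pi> \<and> w = word_prod \<alpha>s" for n
      using that card_inversions_le by blast
  qed
qed

text \<open>The reduced word then has length zero.\<close>

lemma inversions_empty:
  assumes "w \<in> weyl_group v" "inversions w = {}" shows "w = id"
proof -
  obtain \<beta>s where \<beta>s: "set \<beta>s \<subseteq> \<Pi>" "w = word_prod \<beta>s"
    using weyl_group_principal_word [OF assms(1)] by blast
  then show ?thesis using reduced_word [OF \<beta>s(1)] assms(2) by auto
qed

section \<open>Inversions as differences of positive systems, and uniqueness\<close>

lemma positive_weyl_act_Sp:
  assumes "w \<in> weyl_group v" "u \<in> Sp v" "\<beta> \<in> \<Delta>"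
  shows "\<beta> \<in> P (weyl_act w u) \<longleftrightarrow> \<beta> \<circ> w \<in> P v"
  using weyl_group_word [OF assms(1)] positive_weyl_act [OF _ Sp_subset_Sk [OF assms(2)] assms(3)]
    positive_Sp [OF assms(2)] by auto

lemma positive_diff_weyl_act:
  assumes "w \<in> weyl_group v" "u \<in> Sp v"
  shows "P v - P (weyl_act w u) = inversions w"
  using positive_weyl_act_Sp [OF assms] by (auto simp: inversions_def positive_iff)

lemma weyl_group_bij: "w \<in> weyl_group v \<Longrightarrow> bij w"
  using weyl_group_word word_bij by blast

lemma weyl_act_Sp_unique:
  assumes "w \<in> weyl_group v" "w' \<in> weyl_group v" "u \<in> Sp v" "u' \<in> Sp v"
    and "weyl_act w u = weyl_act w' u'"
  shows "u = u' \<and> w = w'"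
proof -
  let ?g = "inv w' \<circ> w"
  have inv: "inv w' \<in> weyl_group v" using weyl_inv assms(2) .
  have g: "?g \<in> weyl_group v" using weyl_comp inv assms(1) .
  have bij: "bij w" "bij w'" "bij (inv w')" using weyl_group_bij assms(1,2) inv by auto
  have w': "inv w' \<circ> w' = id" "w' \<circ> inv w' = id"
    using bij(2) by (simp_all add: bij_is_inj fun_eq_iff surj_f_inv_f bij_is_surj)
  have "weyl_act ?g u = weyl_act (inv w' \<circ> w') u'"
    by (simp only: weyl_act_comp [OF bij(3,1)] weyl_act_comp [OF bij(3,2)] assms(5))
  then have u': "weyl_act ?g u = u'" by (simp add: w' weyl_act_id)
  \<comment> \<open>Both u and u' = g(u) lie on the spine and have the positive system of v, so the
    difference that computes the inversions is empty.\<close>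
  have "inversions ?g = {}"
    using positive_diff_weyl_act [OF g assms(3)] u' positive_Sp [OF assms(4)] by simp
  then have id: "?g = id" by (rule inversions_empty [OF g])
  then have "w = w'"
    using w'(2) by (metis comp_assoc comp_id id_comp)
  moreover have "u = u'" using u' id by (simp add: weyl_act_id)
  ultimately show ?thesis by blast
qed

end

section \<open>From admissibility to the theorem\<close>

lemma skeleton_admissible:
  fixes v :: "('h::ab_group_add, 'x::finite) root_data"
  assumes "is_root_datum v" "admissible (component v)"
  shows "skeleton v"
proof -
  obtain I where I: "\<And>u. u \<in> component v \<Longrightarrow>
      graded_ideal (hb u) (I u) \<and> (\<forall>h. hb_cls u (Car h) \<in> I u \<longrightarrow> h = 0)"
    and iso: "\<And>u u' \<phi>. u \<in> component v \<Longrightarrow> arrow u u' \<phi> \<Longrightarrow>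
      \<exists>\<Psi>. lsa_iso (quotient_lsa (hb u) (I u)) (quotient_lsa (hb u') (I u')) \<Psi> \<and>
        (\<forall>h. \<Psi> (coset (hb u) (I u) (hb_cls u (Car h))) =
             coset (hb u') (I u') (hb_cls u' (Car (\<phi> h))))"
    using assms(2) unfolding admissible_def by (elim exE conjE) blast
  have hb: "(nonneg_span u' (rt u x) \<or> nonneg_span u' (\<lambda>h. - rt u x h)) \<and>
      (rt u x = rt u' x' \<longrightarrow> (\<exists>c. cor u x = smult u' c (cor u' x')))"
    if Sk: "u \<in> Sk v" "u' \<in> Sk v" for u u' x x'
  proof -
    have arrow: "arrow v u id" "arrow v u' id" using Sk_arrow assms(1) Sk by blast+
    then have comp: "u \<in> component v" "u' \<in> component v" by (auto simp: component_def)
    \<comment> \<open>Back to v and on to u': the composite still induces the identity, so the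
      isomorphism given by admissibility fixes the Cartan space as \<open>hb_iso\<close>
      requires.\<close>
    have "arrow u u' id" using arrow_comp [OF arrow_inv [OF arrow(1)] arrow(2)] by simp
    from iso [OF comp(1) this] obtain \<Psi> where
      "lsa_iso (quotient_lsa (hb u) (I u)) (quotient_lsa (hb u') (I u')) \<Psi>"
      "\<And>h. \<Psi> (coset (hb u) (I u) (hb_cls u (Car h))) = coset (hb u') (I u') (hb_cls u' (Car h))"
      by auto
    moreover have "is_root_datum u" "is_root_datum u'" using Sk_root_datum assms(1) Sk by blast+
    ultimately have "hb_iso u u' (I u) (I u') \<Psi>"
      using I [OF comp(1)] I [OF comp(2)]
      by (intro hb_iso.intro hb_quotient.intro hb_iso_axioms.intro) auto
    from hb_iso.root_sign [OF this] hb_iso.coroot_unique_up_to_scalar [OF this]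
    show ?thesis by blast
  qed
  show ?thesis
  proof
    fix u u' x x' assume Sk: "u \<in> Sk v" "u' \<in> Sk v" and "rt u x = rt u' x'"
    with hb [OF Sk, of x x'] show "\<exists>c. cor u x = smult v c (cor u' x')"
      using Sk_root_datum [OF Sk(2) assms(1)] by simp
  qed (use hb assms(1) in blast)+
qed

theorem corollary5p2p9:
  fixes v v' :: "('h::ab_group_add, 'x::finite) root_data"
  assumes "is_root_datum v"
    and "indecomposable (component v)"
    and "admissible (component v)"
    and "v' \<in> Sk v"
  shows "(\<exists>!(v'', w). v'' \<in> Sp v \<and> w \<in> weyl_group v \<and> v' = weyl_act w v'') \<and>
         (\<forall>v''\<in>Sp v. \<forall>w\<in>weyl_group v. v' = weyl_act w v'' \<longrightarrow>
            finite (positive_anisotropic v v - positive_anisotropic v v') \<and>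
            card (positive_anisotropic v v - positive_anisotropic v v') = weyl_length v w)"
proof (intro conjI ballI impI)
  interpret skeleton v by (rule skeleton_admissible [OF assms(1,3)])
  obtain u \<beta>s where u: "u \<in> Sp v" "set \<beta>s \<subseteq> \<Pi>" "v' = weyl_act (word_prod \<beta>s) u"
    using Sk_decomposition [OF assms(4)] by blast
  have w: "word_prod \<beta>s \<in> weyl_group v"
    using word_weyl_group u(2) principal_subset by blast
  show "\<exists>!(v'', w). v'' \<in> Sp v \<and> w \<in> weyl_group v \<and> v' = weyl_act w v''"
  proof (rule ex1I [of _ "(u, word_prod \<beta>s)"])
    show "case (u, word_prod \<beta>s) of
        (v'', w) \<Rightarrow> v'' \<in> Sp v \<and> w \<in> weyl_group v \<and> v' = weyl_act w v''"
      unfolding prod.case using u(1) w u(3) by (intro conjI)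
    fix p assume p: "case p of (v'', w) \<Rightarrow> v'' \<in> Sp v \<and> w \<in> weyl_group v \<and> v' = weyl_act w v''"
    obtain v'' w' where eq: "p = (v'', w')" by (cases p)
    have p: "v'' \<in> Sp v" "w' \<in> weyl_group v" "v' = weyl_act w' v''"
      using p unfolding eq by simp_all
    have "weyl_act w' v'' = weyl_act (word_prod \<beta>s) u" using p(3) u(3) by (rule subst)
    from weyl_act_Sp_unique [OF p(2) w p(1) u(1) this]
    show "p = (u, word_prod \<beta>s)" unfolding eq by simp
  qed
  fix v'' w assume vw: "v'' \<in> Sp v" "w \<in> weyl_group v" "v' = weyl_act w v''"
  obtain \<gamma>s where "set \<gamma>s \<subseteq> \<Pi>" "w = word_prod \<gamma>s"
    using weyl_group_principal_word [OF vw(2)] by blast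
  then show "finite (P v - P v')"
    unfolding vw(3) positive_diff_weyl_act [OF vw(2,1)] using finite_inversions by simp
  show "card (P v - P v') = weyl_length v w"
    unfolding vw(3) positive_diff_weyl_act [OF vw(2,1)] weyl_length_inversions [OF vw(2)] ..
qed

end
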